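(* Let $f:\mathbb{C}^n\to\mathbb{C}^N$ be a polynomial map that restricts to a proper map $\mathbb{B}^n\to\mathbb{B}^N$, with $f(0)=0$ and of degree at least $2$. Let $A\subseteq\mathbb{C}^N$ be the subspace spanned by the coefficient vectors of the lowest order part of $f$, and write $Ef=\big((\pi_A f)\otimes z\big)\oplus(1-\pi_A)f$. Then $$\Gamma_f\subseteq\Gamma_{Ef}.$$
   Context: $\mathbb{B}^n$ is the open unit ball of $\mathbb{C}^n$ and $\mathrm{Aut}(\mathbb{B}^n)$ is its group of holomorphic automorphisms. For a rational proper map $f:\mathbb{B}^n\to\mathbb{B}^N$, the Hermitian invariant group is $$\Gamma_f=\{\gamma\in\mathrm{Aut}(\mathbb{B}^n):\ \text{there is } \psi\in\mathrm{Aut}(\mathbb{B}^N)\text{ with } f\circ\gamma=\psi\circ f\}.$$ Write $f=\sum_{j=\nu}^d f_j$ with $f_j$ vector-valued and homogeneous of degree $j$, and $f_\nu\neq 0$; the lowest order part of $f$ is $f_\nu=\sum_{|\alpha|=\nu}A_\alpha z^\alpha$, with coefficient vectors $A_\alpha\in\mathbb{C}^N$. $\pi_A$ is orthogonal projection of $\mathbb{C}^N$ onto $A$. The map $Ef$ takes values in $(A\otimes\mathbb{C}^n)\oplus A^\perp$ (orthogonal sum, identified with a complex Euclidean space), where $((\pi_Af)\otimes z)$ is the map $z\mapsto(\pi_Af(z))\otimes z$; it is again a polynomial proper map between unit balls. *)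

theory Defs
  imports "HOL-Analysis.Analysis" "HOL-Library.Poly_Mapping"
begin

section \<open>Vector-valued polynomials in several complex variables\<close>

text \<open>
  A polynomial map from \<open>\<complex>\<^sup>n\<close> to \<open>\<complex>\<^sup>N\<close> is given by its finitely supported family of
  coefficient vectors, indexed by multi-indices \<open>'n \<Rightarrow> nat\<close>.
\<close>

type_synonym ('n, 'm) vpoly = "('n \<Rightarrow> nat) \<Rightarrow>\<^sub>0 complex ^ 'm"

definition mi_degree :: "('n::finite \<Rightarrow> nat) \<Rightarrow> nat" where
  "mi_degree \<alpha> = (\<Sum>i\<in>UNIV. \<alpha> i)"

definition poly_map :: "('n::finite, 'm::finite) vpoly \<Rightarrow> complex ^ 'n \<Rightarrow> complex ^ 'm" where
  "poly_map p z = (\<Sum>\<alpha>\<in>Poly_Mapping.keys p. (\<Prod>i\<in>UNIV. (z $ i) ^ \<alpha> i) *s Poly_Mapping.lookup p \<alpha>)"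

text \<open>The following two are meaningful for \<open>p \<noteq> 0\<close> only.\<close>

definition vpoly_degree :: "('n::finite, 'm::finite) vpoly \<Rightarrow> nat" where
  "vpoly_degree p = Max (mi_degree ` Poly_Mapping.keys p)"

definition lowest_order :: "('n::finite, 'm::finite) vpoly \<Rightarrow> nat" where
  "lowest_order p = Min (mi_degree ` Poly_Mapping.keys p)"

definition lowest_coeff_span :: "('n::finite, 'm::finite) vpoly \<Rightarrow> (complex ^ 'm) set" where
  "lowest_coeff_span p = vec.span {Poly_Mapping.lookup p \<alpha> |\<alpha>. mi_degree \<alpha> = lowest_order p}"


section \<open>Automorphisms of unit balls and the Hermitian invariant group\<close>

text \<open>
  On a relatively open subset \<open>S\<close> of a complex subspace, this is holomorphy in the usual sense
  (complex Frechet differentiability along the subspace): the derivative is taken within \<open>S\<close>,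
  and a complex-linear map on the subspace always extends to the ambient space.
\<close>

definition holomorphic_map_on ::
    "(complex ^ 'a::finite \<Rightarrow> complex ^ 'b::finite) \<Rightarrow> (complex ^ 'a) set \<Rightarrow> bool" where
  "holomorphic_map_on f S \<longleftrightarrow>
     (\<forall>z\<in>S. \<exists>f'. Vector_Spaces.linear (*s) (*s) f' \<and> (f has_derivative f') (at z within S))"

definition unit_ball :: "(complex ^ 'a::finite) set \<Rightarrow> (complex ^ 'a) set" where
  "unit_ball V = V \<inter> ball 0 1"

text \<open>
  Automorphisms of the unit ball of a complex subspace \<open>V\<close>; extensionality only makes an
  automorphism determined by its values on the ball.
\<close>

definition Aut_ball ::
    "(complex ^ 'a::finite) set \<Rightarrow> (complex ^ 'a \<Rightarrow> complex ^ 'a) set" where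
  "Aut_ball V = {\<phi> \<in> extensional (unit_ball V).
     bij_betw \<phi> (unit_ball V) (unit_ball V) \<and>
     holomorphic_map_on \<phi> (unit_ball V) \<and>
     holomorphic_map_on (inv_into (unit_ball V) \<phi>) (unit_ball V)}"

text \<open>
  \<open>\<Gamma>\<close> of a map whose target is the unit ball of the complex subspace \<open>V\<close>; for a map into the
  standard ball, \<open>V = UNIV\<close>.
\<close>

definition hermitian_invariant_group ::
    "(complex ^ 'b::finite) set \<Rightarrow> (complex ^ 'a::finite \<Rightarrow> complex ^ 'b)
      \<Rightarrow> (complex ^ 'a \<Rightarrow> complex ^ 'a) set" where
  "hermitian_invariant_group V f =
     {\<gamma> \<in> Aut_ball UNIV. \<exists>\<psi>\<in>Aut_ball V. \<forall>z\<in>unit_ball UNIV. f (\<gamma> z) = \<psi> (f z)}"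


section \<open>The partial tensor operation\<close>

text \<open>The Hermitian inner product; the library's \<open>inner\<close> on \<open>complex ^ 'a\<close> is its real part.\<close>

definition hinner :: "complex ^ 'a::finite \<Rightarrow> complex ^ 'a \<Rightarrow> complex" where
  "hinner x y = (\<Sum>i\<in>UNIV. x $ i * cnj (y $ i))"

definition hcompl :: "(complex ^ 'a::finite) set \<Rightarrow> (complex ^ 'a) set" where
  "hcompl A = {x. \<forall>a\<in>A. hinner x a = 0}"

definition hproj :: "(complex ^ 'a::finite) set \<Rightarrow> complex ^ 'a \<Rightarrow> complex ^ 'a" where
  "hproj A x = (THE y. y \<in> A \<and> x - y \<in> hcompl A)"

definition tensor ::
    "complex ^ 'a::finite \<Rightarrow> complex ^ 'b::finite \<Rightarrow> complex ^ ('a \<times> 'b)" (infixl "\<otimes>\<^sub>v" 75) where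
  "x \<otimes>\<^sub>v y = (\<chi> k. x $ fst k * y $ snd k)"

definition dsum ::
    "complex ^ 'a::finite \<Rightarrow> complex ^ 'b::finite \<Rightarrow> complex ^ ('a + 'b)" (infixl "\<oplus>\<^sub>v" 65) where
  "x \<oplus>\<^sub>v y = (\<chi> k. case k of Inl i \<Rightarrow> x $ i | Inr j \<Rightarrow> y $ j)"

text \<open>
  The complex Euclidean space \<open>(A \<otimes> \<complex>\<^sup>n) \<oplus> A\<^sup>\<bottom>\<close>, as a subspace of \<open>(\<complex>\<^sup>N \<otimes> \<complex>\<^sup>n) \<oplus> \<complex>\<^sup>N\<close>
  with the induced norm. Its dimension depends on \<open>A\<close>, so it is not itself of the form \<open>complex ^ 'm\<close>.
\<close>

definition tensor_target ::
    "(complex ^ 'm::finite) set \<Rightarrow> (complex ^ ('m \<times> 'n::finite + 'm)) set" where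
  "tensor_target A = {u \<oplus>\<^sub>v v |u v. u \<in> vec.span {a \<otimes>\<^sub>v z |a z. a \<in> A} \<and> v \<in> hcompl A}"

definition tensor_op ::
    "(complex ^ 'm::finite) set \<Rightarrow> (complex ^ 'n::finite \<Rightarrow> complex ^ 'm)
      \<Rightarrow> complex ^ 'n \<Rightarrow> complex ^ ('m \<times> 'n + 'm)" where
  "tensor_op A f z = (hproj A (f z) \<otimes>\<^sub>v z) \<oplus>\<^sub>v (f z - hproj A (f z))"

end

theory Submission
  imports Defs "HOL-Complex_Analysis.Conformal_Mappings"
begin

text \<open>
  The inclusion follows once it is known that every symmetry is linear: if \<open>f \<circ> \<gamma> = \<psi> \<circ> f\<close>, then
  \<open>\<gamma>\<close> and \<open>\<psi>\<close> are the restrictions of unitary maps \<open>U\<close> and \<open>V\<close>. Comparing terms of lowest degree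
  in \<open>f \<circ> U = V \<circ> f\<close> shows that \<open>V\<close> preserves the span \<open>A\<close> of the lowest order coefficients. Then
  \<open>V\<close> commutes with the orthogonal projection onto \<open>A\<close>, so \<open>E f \<circ> U = ((V \<otimes> U) \<oplus> V) \<circ> E f\<close>, and
  the unitary map \<open>(V \<otimes> U) \<oplus> V\<close> preserves \<open>(A \<otimes> \<complex>\<^sup>n) \<oplus> A\<^sup>\<bottom>\<close>.

  The Schwarz lemma on complex lines through the origin gives Cartan's theorem that automorphisms
  fixing the origin are unitary (\<open>cartan_linear\<close>). With the Moebius involutions \<open>\<phi>\<^sub>a\<close> every
  automorphism becomes \<open>U \<circ> \<phi>\<^sub>a\<close>, where \<open>a\<close> is its zero (\<open>ball_automorphism_structure\<close>). So it
  remains to see that \<open>\<gamma> = U \<circ> \<phi>\<^sub>a\<close> has \<open>a = 0\<close>; then \<open>\<psi>(0) = \<psi>(f(0)) = f(\<gamma>(0)) = 0\<close> as well.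

  Here the degree \<open>d \<ge> 2\<close> enters (\<open>symmetry_center_eq_0\<close>). Write \<open>\<psi> = V \<circ> \<phi>\<^sub>b\<close>; necessarily
  \<open>b = f(a)\<close>. The denominator of \<open>\<phi>\<^sub>a(z)\<close> is \<open>1 - \<langle>z, a\<rangle>\<close>, hence \<open>f \<circ> \<gamma>\<close> has a pole of order
  exactly \<open>d\<close> at the generic point of the hyperplane \<open>\<langle>z, a\<rangle> = 1\<close>. On the other side the
  denominator of \<open>\<psi> \<circ> f\<close> is \<open>1 - \<langle>f(z), b\<rangle>\<close>, a polynomial of degree at most \<open>d\<close> with value \<open>1\<close> at
  the origin. This forces \<open>1 - \<langle>f(z), b\<rangle> = (1 - \<langle>z, a\<rangle>)\<^sup>d\<close>. At \<open>z = a\<close> it reads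
  \<open>1 - |f(a)|\<^sup>2 = (1 - |a|\<^sup>2)\<^sup>d\<close>, whereas the Schwarz lemma gives \<open>|f(a)| \<le> |a|\<close>, that is,
  \<open>1 - |f(a)|\<^sup>2 \<ge> 1 - |a|\<^sup>2\<close>. For \<open>d \<ge> 2\<close> and \<open>0 < |a| < 1\<close> these contradict each other.
\<close>

section \<open>Hermitian geometry and linear isometries\<close>

abbreviation complex_linear :: "(complex ^ 'a::finite \<Rightarrow> complex ^ 'b::finite) \<Rightarrow> bool" where
  "complex_linear \<equiv> Vector_Spaces.linear (*s) (*s)"

lemma hinner_add_left: "hinner (x + y) z = hinner x z + hinner y z"
  and hinner_add_right: "hinner x (y + z) = hinner x y + hinner x z"
  and hinner_diff_left: "hinner (x - y) z = hinner x z - hinner y z"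
  and hinner_diff_right: "hinner x (y - z) = hinner x y - hinner x z"
  and hinner_scale_left: "hinner (c *s x) z = c * hinner x z"
  and hinner_scale_right: "hinner x (c *s z) = cnj c * hinner x z"
  and hinner_zero_left [simp]: "hinner 0 x = 0"
  and hinner_zero_right [simp]: "hinner x 0 = 0"
  by (simp_all add: hinner_def algebra_simps sum.distrib sum_subtractf sum_distrib_left)

lemmas hinner_simps = hinner_add_left hinner_add_right hinner_diff_left hinner_diff_right
  hinner_scale_left hinner_scale_right

lemma hinner_sum_left: "hinner (sum g S) y = (\<Sum>i\<in>S. hinner (g i) y)"
  by (induction S rule: infinite_finite_induct) (simp_all add: hinner_add_left)

lemma cnj_hinner: "cnj (hinner x y) = hinner y x"
  by (simp add: hinner_def mult.commute)

lemma Re_hinner: "Re (hinner x y) = inner x y"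
  by (simp add: hinner_def inner_vec_def inner_complex_def)

lemma hinner_self: "hinner x x = of_real ((norm x)\<^sup>2)"
proof (rule complex_eqI)
  show "Re (hinner x x) = Re (of_real ((norm x)\<^sup>2))"
    by (simp add: Re_hinner power2_norm_eq_inner)
  show "Im (hinner x x) = Im (of_real ((norm x)\<^sup>2))"
    by (simp add: hinner_def)
qed

lemma hinner_self_eq_0 [simp]: "hinner x x = 0 \<longleftrightarrow> x = 0"
  by (simp add: hinner_self)

lemma norm_scale_vec: "norm (c *s x) = cmod c * norm (x :: complex ^ 'a::finite)"
  by (simp add: norm_vec_def norm_mult L2_set_right_distrib)

lemma of_real_scale_vec: "complex_of_real r *s x = r *\<^sub>R (x :: complex ^ 'a::finite)"
  by (simp add: vec_eq_iff complex_eq_iff)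

lemma norm_diff_hinner:
  "(norm (x - y))\<^sup>2 = (norm x)\<^sup>2 - 2 * Re (hinner x y) + (norm y)\<^sup>2"
  by (simp add: Re_hinner power2_norm_eq_inner inner_diff inner_commute)

text \<open>
  Multiplying \<open>x\<close> by a unimodular constant makes \<open>hinner x y\<close> real and nonnegative, which reduces
  the estimate to Cauchy--Schwarz for the real inner product.
\<close>
lemma norm_hinner_le: "cmod (hinner x y) \<le> norm x * norm y"
proof (cases "hinner x y = 0")
  case False
  define h where "h = hinner x y"
  define c where "c = cnj h / cmod h"
  have h: "h \<noteq> 0" using False by (simp add: h_def)
  have c1: "cmod c = 1" using h by (simp add: c_def norm_divide)
  have "c * h = h * cnj h / cmod h" by (simp add: c_def)
  also have "\<dots> = complex_of_real ((cmod h)\<^sup>2) / cmod h" by (simp only: complex_norm_square)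
  also have "\<dots> = cmod h" using h by (simp add: power2_eq_square)
  finally have c2: "c * hinner x y = cmod (hinner x y)" by (simp only: h_def)
  have "cmod (hinner x y) = Re (hinner (c *s x) y)"
    by (simp only: hinner_scale_left c2 Re_complex_of_real)
  also have "\<dots> \<le> norm (c *s x) * norm y"
    by (simp add: Re_hinner norm_cauchy_schwarz)
  finally show ?thesis using c1 by (simp add: norm_scale_vec)
qed auto

lemma complex_linear_imp_linear: "complex_linear f \<Longrightarrow> linear f"
  by (rule linearI) (simp_all add: vec.linear_add vec.linear_scale flip: of_real_scale_vec)

lemma bounded_linear_hinner: "bounded_linear (\<lambda>x. hinner x w)"
proof -
  have "linear (\<lambda>x. hinner x w)"
    by (rule linearI)
      (simp_all add: hinner_add_left hinner_scale_left complex_eq_iff of_real_scale_vec[symmetric])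
  then show ?thesis by (simp add: linear_conv_bounded_linear)
qed

lemma bounded_bilinear_scale_vec: "bounded_bilinear ((*s) :: complex \<Rightarrow> complex ^ 'a::finite \<Rightarrow> _)"
proof
  show "\<exists>K. \<forall>(a::complex) (b :: complex ^ 'a). norm (a *s b) \<le> norm a * norm b * K"
    by (rule exI[of _ 1]) (simp add: norm_scale_vec)
qed (simp_all add: vec_eq_iff algebra_simps)

lemma unit_ball_UNIV: "unit_ball UNIV = ball 0 1"
  by (simp add: unit_ball_def)

definition hermitian_isometry :: "(complex ^ 'a::finite \<Rightarrow> complex ^ 'a) \<Rightarrow> bool" where
  "hermitian_isometry U \<longleftrightarrow> complex_linear U \<and> (\<forall>x. norm (U x) = norm x)"

lemma hermitian_isometry_linear: "hermitian_isometry U \<Longrightarrow> complex_linear U"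
  and hermitian_isometry_norm: "hermitian_isometry U \<Longrightarrow> norm (U x) = norm x"
  by (simp_all add: hermitian_isometry_def)

text \<open>
  Polarization: norms determine the real parts of Hermitian products, and the imaginary part of
  \<open>hinner x y\<close> is the real part of \<open>hinner x (\<i> *s y)\<close>.
\<close>
lemma hermitian_isometry_hinner:
  assumes "hermitian_isometry U"
  shows "hinner (U x) (U y) = hinner x y"
proof -
  have re: "Re (hinner (U x) (U y)) = Re (hinner x y)" for x y
    using norm_diff_hinner[of "U x" "U y"] norm_diff_hinner[of x y] assms
    by (simp add: hermitian_isometry_def flip: vec.linear_diff)
  have "Im (hinner v w) = Re (hinner v (\<i> *s w))" for v w :: "complex ^ 'a"
    by (simp add: hinner_scale_right)
  then show ?thesis
    using re[of x y] re[of x "\<i> *s y"] assms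
    by (simp add: complex_eq_iff hermitian_isometry_def vec.linear_scale)
qed

lemma hermitian_isometry_inj: "hermitian_isometry U \<Longrightarrow> inj U"
proof (rule injI)
  fix x y assume "hermitian_isometry U" "U x = U y"
  then have "norm (x - y) = 0"
    by (simp add: hermitian_isometry_linear vec.linear_diff flip: hermitian_isometry_norm[of U "x - y"])
  then show "x = y" by simp
qed

lemma hermitian_isometry_inverse:
  assumes "hermitian_isometry U"
  obtains W where "hermitian_isometry W" "\<And>x. W (U x) = x" "\<And>x. U (W x) = x"
proof -
  have lin: "complex_linear U" and inj: "inj U"
    using assms by (simp_all add: hermitian_isometry_linear hermitian_isometry_inj)
  obtain W where W: "complex_linear W" "W \<circ> U = id"
    using vec.linear_injective_left_inverse[OF lin inj] by blast
  have "surj U" using vec.linear_inj_imp_surj[OF lin inj] .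
  then have UW: "U (W x) = x" for x
    by (metis W(2) comp_apply id_apply surjD)
  have "norm (W x) = norm x" for x
    using hermitian_isometry_norm[OF assms, of "W x"] by (simp add: UW)
  then have "hermitian_isometry W" using W(1) by (simp add: hermitian_isometry_def)
  moreover have "W (U x) = x" for x using W(2) by (simp add: fun_eq_iff)
  ultimately show ?thesis using UW that by blast
qed

lemma hermitian_isometry_image_subspace:
  assumes U: "hermitian_isometry U" and V: "vec.subspace V" and sub: "U ` V \<subseteq> V"
  shows "U ` V = V"
proof (rule vec.subspace_dim_equal)
  show "vec.subspace (U ` V)"
    by (rule vec.linear_subspace_image[OF hermitian_isometry_linear[OF U] V])
  have "vec.dim (U ` V) = vec.dim V"
    by (rule vec.dim_image_eq[OF hermitian_isometry_linear[OF U]])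
      (meson U hermitian_isometry_inj inj_on_subset subset_UNIV)
  then show "vec.dim (U ` V) \<ge> vec.dim V" by simp
qed (use V sub in auto)

section \<open>Automorphisms that fix the origin\<close>

lemma holomorphic_slice:
  assumes F: "holomorphic_map_on F (ball 0 1)" and u: "norm u \<le> 1"
  shows "(\<lambda>\<zeta>. hinner (F (\<zeta> *s u)) w) holomorphic_on ball 0 1"
proof (rule holomorphic_onI)
  fix \<zeta> :: complex assume "\<zeta> \<in> ball 0 1"
  then have "\<zeta> *s u \<in> ball 0 1"
    using u by (simp add: norm_scale_vec) (smt (verit) mult_left_le norm_ge_zero)
  then obtain F' where F': "complex_linear F'" "(F has_derivative F') (at (\<zeta> *s u))"
    using F unfolding holomorphic_map_on_def by (metis at_within_open open_ball)
  have "((\<lambda>\<zeta>. \<zeta> *s u) has_derivative (\<lambda>h. h *s u)) (at \<zeta>)"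
    by (rule bounded_linear_imp_has_derivative)
      (rule bounded_bilinear.bounded_linear_left[OF bounded_bilinear_scale_vec])
  from has_derivative_compose[OF this F'(2)]
  have "((\<lambda>\<zeta>. hinner (F (\<zeta> *s u)) w) has_derivative (\<lambda>h. hinner (F' (h *s u)) w)) (at \<zeta>)"
    by (rule bounded_linear.has_derivative[OF bounded_linear_hinner])
  moreover have "(\<lambda>h. hinner (F' (h *s u)) w) = (*) (hinner (F' u) w)"
    by (simp add: fun_eq_iff vec.linear_scale[OF F'(1)] hinner_scale_left)
  ultimately show "(\<lambda>\<zeta>. hinner (F (\<zeta> *s u)) w) field_differentiable at \<zeta> within ball 0 1"
    by (metis field_differentiable_def has_field_derivative_def field_differentiable_at_within)
qed

text \<open>
  Both parts come from the one-variable Schwarz lemma applied to \<open>\<zeta> \<mapsto> hinner (F (\<zeta> *s u)) w\<close> with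
  \<open>u = z / |z|\<close> and \<open>w = F z / |F z|\<close>; at \<open>\<zeta> = |z|\<close> this slice takes the value \<open>|F z|\<close>. If
  \<open>|F z| = |z|\<close>, the slice is the identity, and equality in Cauchy--Schwarz recovers
  \<open>F (\<zeta> *s u) = \<zeta> *s w\<close> from it.
\<close>
lemma schwarz_lemma_ball:
  fixes F :: "complex ^ 'a::finite \<Rightarrow> complex ^ 'b::finite"
  assumes F: "holomorphic_map_on F (ball 0 1)" "F ` ball 0 1 \<subseteq> ball 0 1" "F 0 = 0"
    and z: "norm z < 1"
  shows "norm (F z) \<le> norm z"
    and "z \<noteq> 0 \<Longrightarrow> norm (F z) = norm z \<Longrightarrow> norm (\<zeta> *s z) < 1 \<Longrightarrow> F (\<zeta> *s z) = \<zeta> *s F z"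
proof -
  define slice where "slice u w \<zeta> = hinner (F (\<zeta> *s u)) w"
    for u :: "complex ^ 'a" and w :: "complex ^ 'b" and \<zeta>
  have norm_sgn: "norm (sgn x) \<le> 1" for x :: "complex ^ 'c::finite"
    by (simp add: norm_sgn)
  have slice: "slice u w holomorphic_on ball 0 1" "slice u w 0 = 0"
    "\<And>\<zeta>. cmod \<zeta> < 1 \<Longrightarrow> cmod (slice u w \<zeta>) < 1" if "norm u \<le> 1" "norm w \<le> 1" for u w
  proof -
    show "slice u w holomorphic_on ball 0 1"
      unfolding slice_def by (rule holomorphic_slice) (use F that in auto)
    show "slice u w 0 = 0" using F by (simp add: slice_def)
    fix \<zeta> assume "cmod \<zeta> < 1"
    then have "norm (\<zeta> *s u) < 1"
      using that by (simp add: norm_scale_vec) (smt (verit) mult_left_le norm_ge_zero)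
    then have "norm (F (\<zeta> *s u)) < 1" using F(2) by (auto simp: image_subset_iff)
    then show "cmod (slice u w \<zeta>) < 1"
      unfolding slice_def using norm_hinner_le[of "F (\<zeta> *s u)" w] that
      by (smt (verit) mult_left_le norm_ge_zero)
  qed
  have z_eq: "complex_of_real (norm z) *s sgn z = z" for z :: "complex ^ 'c::finite"
    by (cases "z = 0") (simp_all add: of_real_scale_vec sgn_div_norm)
  have at_z: "slice (sgn z) (sgn (F z)) (of_real (norm z)) = of_real (norm (F z))" for z
  proof -
    have "slice (sgn z) (sgn (F z)) (of_real (norm z)) = hinner (F z) (sgn (F z))"
      by (simp add: slice_def z_eq)
    also have "\<dots> = of_real (norm (F z))"
      by (simp add: sgn_div_norm hinner_scale_right hinner_self flip: of_real_scale_vec)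
        (simp add: field_simps power2_eq_square)
    finally show ?thesis .
  qed
  have le: "norm (F z) \<le> norm z" if "norm z < 1" for z
  proof -
    have "cmod (slice (sgn z) (sgn (F z)) (of_real (norm z))) \<le> cmod (of_real (norm z))"
      by (rule Schwarz_Lemma(1)[OF slice[OF norm_sgn norm_sgn]]) (use that in auto)
    then show ?thesis by (simp add: at_z)
  qed
  from le[OF z] show "norm (F z) \<le> norm z" .
  assume "z \<noteq> 0" and eq: "norm (F z) = norm z" and \<zeta>: "norm (\<zeta> *s z) < 1"
  define u w where "u = sgn z" and "w = sgn (F z)"
  have "\<exists>\<alpha>. (\<forall>\<zeta>. cmod \<zeta> < 1 \<longrightarrow> slice u w \<zeta> = \<alpha> * \<zeta>) \<and> cmod \<alpha> = 1"
    unfolding u_def w_def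
  proof (rule Schwarz_Lemma(3)[OF slice[OF norm_sgn norm_sgn], where \<xi> = 0])
    show "(\<exists>\<zeta>. cmod \<zeta> < 1 \<and> \<zeta> \<noteq> 0 \<and> cmod (slice (sgn z) (sgn (F z)) \<zeta>) = cmod \<zeta>) \<or>
      cmod (deriv (slice (sgn z) (sgn (F z))) 0) = 1"
      using at_z[of z] eq z \<open>z \<noteq> 0\<close> by (intro disjI1 exI[of _ "of_real (norm z)"]) simp
  qed auto
  then obtain \<alpha> where \<alpha>: "\<And>\<zeta>. cmod \<zeta> < 1 \<Longrightarrow> slice u w \<zeta> = \<alpha> * \<zeta>" by blast
  have "\<alpha> = 1"
    using \<alpha>[of "of_real (norm z)"] at_z[of z] z \<open>z \<noteq> 0\<close> eq by (simp add: u_def w_def)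
  define \<xi> where "\<xi> = \<zeta> * norm z"
  have \<xi>: "cmod \<xi> < 1" using \<zeta> by (simp add: \<xi>_def norm_mult norm_scale_vec)
  have \<xi>u: "\<xi> *s u = \<zeta> *s z"
    by (simp only: \<xi>_def u_def vec.scale_scale [symmetric] z_eq)
  have \<xi>w: "\<xi> *s w = \<zeta> *s F z"
    by (simp only: \<xi>_def w_def vec.scale_scale [symmetric] eq [symmetric] z_eq)
  have "hinner (F (\<zeta> *s z)) w = \<xi>"
    using \<alpha>[OF \<xi>] \<open>\<alpha> = 1\<close> by (simp add: slice_def \<xi>u)
  then have "hinner (F (\<zeta> *s z)) (\<xi> *s w) = of_real ((cmod \<xi>)\<^sup>2)"
    by (simp only: hinner_scale_right complex_norm_square) (simp add: mult.commute)
  moreover have "norm (F (\<zeta> *s z)) \<le> cmod \<xi>"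
    using le[OF \<zeta>] by (simp add: \<xi>_def norm_mult norm_scale_vec)
  moreover have "norm (\<xi> *s w) \<le> cmod \<xi>"
    by (simp add: \<xi>w norm_scale_vec eq) (simp add: \<xi>_def norm_mult)
  ultimately have "(norm (F (\<zeta> *s z) - \<xi> *s w))\<^sup>2 \<le> 0"
    unfolding norm_diff_hinner
    by (smt (verit) Re_complex_of_real norm_ge_zero power_mono)
  then show "F (\<zeta> *s z) = \<zeta> *s F z" by (simp add: \<xi>w)
qed

text \<open>
  The Schwarz lemma for \<open>F\<close> and for its inverse gives \<open>|F z| = |z|\<close>. The equality case then makes
  \<open>F\<close> homogeneous along each line through the origin, so \<open>F\<close> agrees with its derivative there.
\<close>
lemma cartan_linear:
  fixes F G :: "complex ^ 'a::finite \<Rightarrow> complex ^ 'a"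
  assumes F: "holomorphic_map_on F (ball 0 1)" "F ` ball 0 1 \<subseteq> ball 0 1" "F 0 = 0"
    and G: "holomorphic_map_on G (ball 0 1)" "G ` ball 0 1 \<subseteq> ball 0 1"
    and GF: "\<And>z. norm z < 1 \<Longrightarrow> G (F z) = z"
  obtains U where "hermitian_isometry U" "\<And>z. norm z < 1 \<Longrightarrow> F z = U z"
proof -
  have "G 0 = 0" using GF[of 0] F(3) by simp
  have norm_F: "norm (F z) = norm z" if "norm z < 1" for z
  proof (rule antisym)
    show "norm (F z) \<le> norm z" by (rule schwarz_lemma_ball(1)) (use F that in auto)
    have "norm (F z) < 1" using F(2) that by (auto simp: image_subset_iff)
    then have "norm (G (F z)) \<le> norm (F z)"
      by (intro schwarz_lemma_ball(1)) (use G \<open>G 0 = 0\<close> in auto)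
    then show "norm z \<le> norm (F z)" using GF that by simp
  qed
  obtain U where U: "complex_linear U" "(F has_derivative U) (at 0)"
    using F(1) unfolding holomorphic_map_on_def
    by (metis at_within_open open_ball centre_in_ball zero_less_one)
  have FU: "F z = U z" if "norm z < 1" for z
  proof (cases "z = 0")
    case True
    then show ?thesis using F(3) U(1) by (simp add: vec.linear_0)
  next
    case False
    have "((\<lambda>t. t *\<^sub>R z) has_derivative (\<lambda>t. t *\<^sub>R z)) (at (0::real))"
      by (intro bounded_linear_imp_has_derivative bounded_linear_scaleR_left)
    then have "((\<lambda>t. F (t *\<^sub>R z)) has_derivative (\<lambda>t. U (t *\<^sub>R z))) (at (0::real))"
      by (rule has_derivative_compose) (use U in simp)
    moreover have Ft: "F (t *\<^sub>R z) = t *\<^sub>R F z" if t: "t \<in> ball 0 1" for t :: real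
    proof -
      have "norm (complex_of_real t *s z) < 1"
        using t \<open>norm z < 1\<close> by (simp add: norm_scale_vec)
          (smt (verit) mult_left_le norm_ge_zero)
      then show ?thesis
        using schwarz_lemma_ball(2)[OF F \<open>norm z < 1\<close> False norm_F, OF \<open>norm z < 1\<close>, of "of_real t"]
        by (simp add: of_real_scale_vec)
    qed
    ultimately have "((\<lambda>t. t *\<^sub>R F z) has_derivative (\<lambda>t. U (t *\<^sub>R z))) (at (0::real))"
      by (auto intro: has_derivative_transform_within_open[where s = "ball 0 1"])
    moreover have "((\<lambda>t. t *\<^sub>R F z) has_derivative (\<lambda>t. t *\<^sub>R F z)) (at (0::real))"
      by (intro bounded_linear_imp_has_derivative bounded_linear_scaleR_left)
    ultimately have "(\<lambda>t. U (t *\<^sub>R z)) = (\<lambda>t. t *\<^sub>R F z)"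
      by (rule has_derivative_unique)
    from fun_cong[OF this, of 1] show ?thesis by simp
  qed
  have "norm (U x) = norm x" for x
  proof -
    define r where "r = 1 / (norm x + 1)"
    have r: "r > 0" "norm (r *\<^sub>R x) < 1"
      by (simp_all add: r_def add_nonneg_pos)
    have "r * norm (U x) = norm (U (r *\<^sub>R x))"
      using r(1) U(1) by (simp add: linear_scale[OF complex_linear_imp_linear[OF U(1)]])
    also have "\<dots> = r * norm x"
      using FU[OF r(2)] norm_F[OF r(2)] r(1) by simp
    finally show ?thesis using r(1) by simp
  qed
  with U(1) have "hermitian_isometry U" by (simp add: hermitian_isometry_def)
  then show ?thesis using FU that by blast
qed

section \<open>Moebius involutions and the structure of ball automorphisms\<close>

text \<open>
  \<open>mobius a\<close> is the involutive automorphism \<open>\<phi>\<^sub>a\<close> of the ball that exchanges \<open>0\<close> and \<open>a\<close>. Its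
  numerator is usually written \<open>a - P z - s (z - P z)\<close> with \<open>s = \<surd>(1 - |a|\<^sup>2)\<close> and the projection
  \<open>P z = (\<langle>z, a\<rangle> / |a|\<^sup>2) a\<close>. Since \<open>(1 - s) / |a|\<^sup>2 = 1 / (1 + s)\<close>, the form below is the same
  and makes sense for \<open>a = 0\<close> too, where it gives \<open>z \<mapsto> -z\<close>.
\<close>
definition mobius_scale :: "complex ^ 'a::finite \<Rightarrow> complex" where
  "mobius_scale a = of_real (sqrt (1 - (norm a)\<^sup>2))"

definition mobius_num :: "complex ^ 'a::finite \<Rightarrow> complex ^ 'a \<Rightarrow> complex ^ 'a" where
  "mobius_num a z = a - mobius_scale a *s z - (hinner z a / (1 + mobius_scale a)) *s a"

definition mobius :: "complex ^ 'a::finite \<Rightarrow> complex ^ 'a \<Rightarrow> complex ^ 'a" where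
  "mobius a z = (1 / (1 - hinner z a)) *s mobius_num a z"

lemma mobius_scale_nonzero:
  assumes "norm a < 1"
  shows "mobius_scale a \<noteq> 0" "1 + mobius_scale a \<noteq> 0"
proof -
  have "(norm a)\<^sup>2 < 1" using assms by (simp add: abs_square_less_1)
  then have "sqrt (1 - (norm a)\<^sup>2) > 0" by simp
  then have "Re (mobius_scale a) > 0" by (simp add: mobius_scale_def)
  then show "mobius_scale a \<noteq> 0" "1 + mobius_scale a \<noteq> 0" by (auto simp: complex_eq_iff)
qed

lemma mobius_scale_square:
  assumes "norm a < 1"
  shows "(mobius_scale a)\<^sup>2 = 1 - hinner a a"
proof -
  have "(norm a)\<^sup>2 \<le> 1" using assms by (simp add: abs_square_le_1)
  then show ?thesis by (simp add: mobius_scale_def hinner_self flip: of_real_power)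
qed

lemma mobius_denominator_nonzero:
  assumes "norm a < 1" "norm z < 1"
  shows "1 - hinner z a \<noteq> 0"
proof -
  have "cmod (hinner z a) \<le> norm z * norm a" by (rule norm_hinner_le)
  also have "\<dots> < 1" using assms by (metis mult_strict_mono' norm_ge_zero mult_1)
  finally show ?thesis by auto
qed

lemma mobius_0 [simp]: "mobius a 0 = a"
  by (simp add: mobius_def mobius_num_def)

lemma mobius_involution:
  assumes a: "norm a < 1" and z: "norm z < 1"
  shows "mobius a (mobius a z) = z"
proof -
  define s c where "s = mobius_scale a" and "c = hinner z a"
  have s: "s \<noteq> 0" "1 + s \<noteq> 0" "hinner a a = 1 - s\<^sup>2"
    using mobius_scale_nonzero[OF a] mobius_scale_square[OF a] by (simp_all add: s_def)
  have c: "1 - c \<noteq> 0" using mobius_denominator_nonzero[OF a z] by (simp add: c_def)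
  have w: "mobius a z = (1 / (1 - c)) *s (a - s *s z - (c / (1 + s)) *s a)"
    by (simp add: mobius_def mobius_num_def s_def c_def)
  have "hinner (mobius a z) a = (1 / (1 - c)) * (1 - s\<^sup>2 - s * c - (c / (1 + s)) * (1 - s\<^sup>2))"
    unfolding w by (simp add: hinner_simps s(3) diff_divide_distrib flip: c_def)
  also have "(c / (1 + s)) * (1 - s\<^sup>2) = c * (1 - s)"
    using s(2) by (simp add: field_simps power2_eq_square)
  also have "1 - s\<^sup>2 - s * c - c * (1 - s) = 1 - s\<^sup>2 - c"
    by (simp add: algebra_simps)
  finally have h: "hinner (mobius a z) a = (1 - s\<^sup>2 - c) / (1 - c)"
    by simp
  have D: "1 - hinner (mobius a z) a = s\<^sup>2 / (1 - c)"
    unfolding h using c by (simp add: field_simps)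
  show ?thesis
  proof (unfold vec_eq_iff, rule allI)
    fix i
    define x y where "x = a $ i" and "y = z $ i"
    have "mobius a (mobius a z) $ i =
        (1 - c) / s\<^sup>2 * (x - s * ((1 / (1 - c)) * (x - s * y - c / (1 + s) * x))
          - (1 - s\<^sup>2 - c) / (1 - c) / (1 + s) * x)"
      unfolding mobius_def[of a "mobius a z"] D
      unfolding mobius_num_def[of a "mobius a z"] h s_def[symmetric]
      unfolding w x_def y_def vector_minus_component vector_smult_component by simp
    also have "\<dots> = y"
      using s(1,2) c by (simp add: divide_simps) (simp add: algebra_simps power2_eq_square)
    finally show "mobius a (mobius a z) $ i = z $ i" by (simp add: y_def)
  qed
qed

text \<open>
  What keeps \<open>\<phi>\<^sub>a(z)\<close> in the ball: the identity
  \<open>1 - |\<phi>\<^sub>a(z)|\<^sup>2 = (1 - |a|\<^sup>2) (1 - |z|\<^sup>2) / |1 - \<langle>z, a\<rangle>|\<^sup>2\<close> with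
  denominators cleared.
\<close>
lemma norm_mobius_num:
  assumes a: "norm a < 1"
  shows "(norm (mobius_num a z))\<^sup>2
           = (cmod (1 - hinner z a))\<^sup>2 - (1 - (norm a)\<^sup>2) * (1 - (norm z)\<^sup>2)"
proof -
  define s c A where "s = mobius_scale a" and "c = hinner z a" and "A = hinner a a"
  have s: "1 + s \<noteq> 0" "A = 1 - s\<^sup>2" "cnj s = s"
    using mobius_scale_nonzero[OF a] mobius_scale_square[OF a]
    by (simp_all add: s_def mobius_scale_def A_def)
  define k where "k = 1 / (1 + s)"
  have k1: "k * (1 + s) = 1" "cnj k = k"
    using s(1,3) by (simp_all add: k_def)
  have "k * A = (k * (1 + s)) * (1 - s)"
    by (simp add: s(2) algebra_simps power2_eq_square)
  then have k2: "k * A = 1 - s" by (simp add: k1(1))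
  have "k * k * A + 2 * s * k = k * (k * A) + 2 * s * k" by simp
  also have "\<dots> = k * (1 + s)" unfolding k2 by (simp add: algebra_simps)
  finally have k3: "k * k * A + 2 * s * k = 1" by (simp add: k1(1))
  have num: "mobius_num a z = (1 - c * k) *s a - s *s z"
    by (simp add: mobius_num_def s_def k_def c_def vec_eq_iff algebra_simps)
  have ca: "hinner a z = cnj c" by (simp add: c_def cnj_hinner)
  have "complex_of_real ((norm (mobius_num a z))\<^sup>2)
      = (1 - c * k) * (1 - cnj c * k) * A - (1 - c * k) * s * cnj c - s * (1 - cnj c * k) * c
        + s\<^sup>2 * hinner z z"
    unfolding hinner_self [symmetric] num
    by (simp add: hinner_simps A_def [symmetric] c_def [symmetric] ca s(3) k1(2) power2_eq_square
        algebra_simps)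
  also have "\<dots> = A - (c + cnj c) * (k * A + s) + c * cnj c * (k * k * A + 2 * s * k)
      + s\<^sup>2 * hinner z z"
    by (simp add: algebra_simps)
  also have "\<dots> = (1 - c) * cnj (1 - c) - (1 - A) * (1 - hinner z z)"
    unfolding k2 k3 by (simp add: s(2) algebra_simps)
  also have "\<dots> = complex_of_real ((cmod (1 - c))\<^sup>2 - (1 - (norm a)\<^sup>2) * (1 - (norm z)\<^sup>2))"
    unfolding A_def hinner_self by (simp only: of_real_diff of_real_mult of_real_1 complex_norm_square)
  finally show ?thesis unfolding c_def by (simp only: of_real_eq_iff)
qed

lemma norm_mobius_less_1:
  assumes a: "norm a < 1" and z: "norm z < 1"
  shows "norm (mobius a z) < 1"
proof -
  have "(norm a)\<^sup>2 < 1" "(norm z)\<^sup>2 < 1" using a z by (simp_all add: abs_square_less_1)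
  then have "(1 - (norm a)\<^sup>2) * (1 - (norm z)\<^sup>2) > 0" by simp
  then have "(norm (mobius_num a z))\<^sup>2 < (cmod (1 - hinner z a))\<^sup>2"
    using norm_mobius_num[OF a, of z] by linarith
  then have "norm (mobius_num a z) < cmod (1 - hinner z a)"
    by (rule power_less_imp_less_base) simp
  then show ?thesis
    using mobius_denominator_nonzero[OF a z]
    by (simp add: mobius_def norm_scale_vec norm_divide divide_simps)
qed

lemma complex_linearI:
  "(\<And>x y. f (x + y) = f x + f y) \<Longrightarrow> (\<And>c x. f (c *s x) = c *s f x) \<Longrightarrow> complex_linear f"
  by unfold_locales

lemma holomorphic_map_on_mobius:
  assumes a: "norm a < 1"
  shows "holomorphic_map_on (mobius a) (ball 0 1)"
  unfolding holomorphic_map_on_def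
proof
  fix z :: "complex ^ 'a" assume "z \<in> ball 0 1"
  then have z: "norm z < 1" by simp
  define s D where "s = mobius_scale a" and "D = 1 - hinner z a"
  have D: "D \<noteq> 0" using mobius_denominator_nonzero[OF a z] by (simp add: D_def)
  define N' where "N' h = - (s *s h) - (hinner h a / (1 + s)) *s a" for h
  have blin: "bounded_linear N'"
    unfolding N'_def
    by (intro bounded_linear_sub bounded_linear_minus
      bounded_bilinear.bounded_linear_right[OF bounded_bilinear_scale_vec]
      bounded_linear_compose[OF bounded_bilinear.bounded_linear_left[OF bounded_bilinear_scale_vec]]
      bounded_linear_compose[OF bounded_linear_divide bounded_linear_hinner])
  have num: "mobius_num a = (\<lambda>z. a + N' z)"
    by (simp add: fun_eq_iff mobius_num_def N'_def s_def)
  have dnum: "(mobius_num a has_derivative N') (at z)"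
    unfolding num using bounded_linear_imp_has_derivative[OF blin]
    by (auto intro!: derivative_eq_intros)
  have "((\<lambda>z. 1 - hinner z a) has_derivative (\<lambda>h. 0 - hinner h a)) (at z)"
    by (intro has_derivative_diff has_derivative_const
        bounded_linear_imp_has_derivative bounded_linear_hinner)
  from has_derivative_divide[OF has_derivative_const this, of 1]
  have dden: "((\<lambda>z. 1 / (1 - hinner z a)) has_derivative (\<lambda>h. hinner h a / (D * D))) (at z)"
    using D by (simp add: D_def divide_inverse mult_ac)
  have "(mobius a has_derivative
      (\<lambda>h. (1 / D) *s N' h + (hinner h a / (D * D)) *s mobius_num a z)) (at z)"
    unfolding mobius_def [abs_def] D_def
    by (rule bounded_bilinear.FDERIV[OF bounded_bilinear_scale_vec dden[unfolded D_def] dnum])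
  moreover have "complex_linear (\<lambda>h. (1 / D) *s N' h + (hinner h a / (D * D)) *s mobius_num a z)"
    by (rule complex_linearI)
      (simp_all add: N'_def vec_eq_iff hinner_simps algebra_simps add_divide_distrib)
  ultimately show "\<exists>f'. complex_linear f' \<and> (mobius a has_derivative f') (at z within ball 0 1)"
    using has_derivative_at_withinI by blast
qed

lemma holomorphic_map_on_compose:
  assumes f: "holomorphic_map_on f S" and g: "holomorphic_map_on g T" and sub: "f ` S \<subseteq> T"
  shows "holomorphic_map_on (\<lambda>z. g (f z)) S"
  unfolding holomorphic_map_on_def
proof
  fix z assume z: "z \<in> S"
  obtain f' where f': "complex_linear f'" "(f has_derivative f') (at z within S)"
    using f z by (auto simp: holomorphic_map_on_def)
  obtain g' where g': "complex_linear g'" "(g has_derivative g') (at (f z) within T)"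
    using g z sub by (auto simp: holomorphic_map_on_def)
  have "((\<lambda>z. g (f z)) has_derivative (\<lambda>h. g' (f' h))) (at z within S)"
    using f'(2) has_derivative_subset[OF g'(2) sub] by (rule has_derivative_in_compose)
  moreover have "complex_linear (\<lambda>h. g' (f' h))"
    by (rule complex_linearI) (simp_all add: f'(1) g'(1) vec.linear_add vec.linear_scale)
  ultimately show "\<exists>h'. complex_linear h' \<and> ((\<lambda>z. g (f z)) has_derivative h') (at z within S)"
    by blast
qed

text \<open>
  Composing \<open>\<gamma>\<close> with the involution that moves \<open>0\<close> to the zero \<open>a\<close> of \<open>\<gamma>\<close> yields an automorphism
  that fixes the origin, to which Cartan's theorem applies.
\<close>
proposition ball_automorphism_structure:
  fixes \<gamma> :: "complex ^ 'a::finite \<Rightarrow> complex ^ 'a"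
  assumes \<gamma>: "\<gamma> \<in> Aut_ball UNIV"
  obtains U a where "hermitian_isometry U" "norm a < 1" "\<gamma> a = 0"
    "\<And>z. norm z < 1 \<Longrightarrow> \<gamma> z = U (mobius a z)"
proof -
  define \<delta> where "\<delta> = inv_into (ball 0 1) \<gamma>"
  have bij: "bij_betw \<gamma> (ball 0 1) (ball 0 1)" and hol: "holomorphic_map_on \<gamma> (ball 0 1)"
    and hol': "holomorphic_map_on \<delta> (ball 0 1)"
    using \<gamma> by (simp_all add: Aut_ball_def unit_ball_UNIV \<delta>_def)
  have \<gamma>_ball: "\<gamma> ` ball 0 1 \<subseteq> ball 0 1" and \<delta>_ball: "\<delta> ` ball 0 1 \<subseteq> ball 0 1"
    using bij bij_betw_inv_into[OF bij] by (simp_all add: bij_betw_def \<delta>_def)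
  have \<delta>\<gamma>: "\<delta> (\<gamma> z) = z" and \<gamma>\<delta>: "\<gamma> (\<delta> z) = z" if "norm z < 1" for z
    using bij_betw_inv_into_left[OF bij] bij_betw_inv_into_right[OF bij] that
    by (simp_all add: \<delta>_def)
  define a where "a = \<delta> 0"
  have a: "norm a < 1" using \<delta>_ball by (auto simp: a_def image_subset_iff)
  have \<gamma>a: "\<gamma> a = 0" by (simp add: a_def \<gamma>\<delta>)
  have mob_ball: "mobius a ` ball 0 1 \<subseteq> ball 0 1"
    using norm_mobius_less_1[OF a] by auto
  obtain U where U: "hermitian_isometry U" "\<And>z. norm z < 1 \<Longrightarrow> \<gamma> (mobius a z) = U z"
  proof (rule cartan_linear[of "\<lambda>z. \<gamma> (mobius a z)" "\<lambda>z. mobius a (\<delta> z)"])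
    show "holomorphic_map_on (\<lambda>z. \<gamma> (mobius a z)) (ball 0 1)"
      by (rule holomorphic_map_on_compose[OF holomorphic_map_on_mobius[OF a] hol mob_ball])
    show "holomorphic_map_on (\<lambda>z. mobius a (\<delta> z)) (ball 0 1)"
      by (rule holomorphic_map_on_compose[OF hol' holomorphic_map_on_mobius[OF a] \<delta>_ball])
    show "(\<lambda>z. \<gamma> (mobius a z)) ` ball 0 1 \<subseteq> ball 0 1"
      "(\<lambda>z. mobius a (\<delta> z)) ` ball 0 1 \<subseteq> ball 0 1"
      using mob_ball \<gamma>_ball \<delta>_ball by (auto simp: image_subset_iff)
    show "mobius a (\<delta> (\<gamma> (mobius a z))) = z" if "norm z < 1" for z
      using that by (simp add: \<delta>\<gamma> norm_mobius_less_1 mobius_involution a)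
  qed (use \<gamma>a in auto)
  have "\<gamma> z = U (mobius a z)" if "norm z < 1" for z
    using U(2)[of "mobius a z"] that by (simp add: norm_mobius_less_1 mobius_involution a)
  then show ?thesis using U(1) a \<gamma>a that by blast
qed

section \<open>Homogeneous parts of vector-valued polynomials\<close>

definition mi_power :: "complex ^ 'n::finite \<Rightarrow> ('n \<Rightarrow> nat) \<Rightarrow> complex" where
  "mi_power z \<alpha> = (\<Prod>i\<in>UNIV. (z $ i) ^ \<alpha> i)"

definition homog_part :: "('n::finite, 'm::finite) vpoly \<Rightarrow> nat \<Rightarrow> complex ^ 'n \<Rightarrow> complex ^ 'm" where
  "homog_part p k z =
     (\<Sum>\<alpha> | \<alpha> \<in> Poly_Mapping.keys p \<and> mi_degree \<alpha> = k. mi_power z \<alpha> *s Poly_Mapping.lookup p \<alpha>)"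

lemma mi_power_scale: "mi_power (c *s z) \<alpha> = c ^ mi_degree \<alpha> * mi_power z \<alpha>"
  by (simp add: mi_power_def mi_degree_def power_mult_distrib prod.distrib power_sum)

lemma homog_part_scale: "homog_part p k (c *s z) = c ^ k *s homog_part p k z"
  by (simp add: homog_part_def mi_power_scale vec.scale_sum_right vec.scale_scale)

lemma vpoly_degree_ge: "\<alpha> \<in> Poly_Mapping.keys p \<Longrightarrow> mi_degree \<alpha> \<le> vpoly_degree p"
  by (simp add: vpoly_degree_def)

lemma poly_map_homog_parts: "poly_map p z = (\<Sum>k\<le>vpoly_degree p. homog_part p k z)"
  unfolding poly_map_def homog_part_def mi_power_def
  by (rule sum.group [symmetric]) (auto simp: vpoly_degree_ge)

lemma poly_map_scale:
  "poly_map p (c *s z) = (\<Sum>k\<le>vpoly_degree p. c ^ k *s homog_part p k z)"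
  by (simp add: poly_map_homog_parts homog_part_scale)

text \<open>
  Distinct monomials are linearly independent as functions. The variables are treated one at a
  time: in the variable \<open>j\<close> the sum is a one-variable polynomial, so for each power of \<open>z j\<close> the
  sub-sum of the terms with that power vanishes on its own.
\<close>
lemma monomials_independent:
  fixes c :: "('i \<Rightarrow> nat) \<Rightarrow> complex"
  assumes "finite S" "finite K"
    and "\<And>\<alpha> \<beta>. \<alpha> \<in> K \<Longrightarrow> \<beta> \<in> K \<Longrightarrow> (\<And>i. i \<in> S \<Longrightarrow> \<alpha> i = \<beta> i) \<Longrightarrow> \<alpha> = \<beta>"
    and "\<And>z. (\<Sum>\<alpha>\<in>K. c \<alpha> * (\<Prod>i\<in>S. z i ^ \<alpha> i)) = 0"
    and "\<beta> \<in> K"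
  shows "c \<beta> = 0"
  using assms
proof (induction S arbitrary: K rule: finite_induct)
  case empty
  then have "K = {\<beta>}" by auto
  then show ?case using empty.prems(3)[of undefined] by simp
next
  case (insert j S)
  define K' where "K' = {\<alpha> \<in> K. \<alpha> j = \<beta> j}"
  show ?case
  proof (rule insert.IH[of K'])
    show "finite K'" "\<beta> \<in> K'" using insert.prems by (auto simp: K'_def)
    show "\<alpha> = \<alpha>'" if "\<alpha> \<in> K'" "\<alpha>' \<in> K'" "\<And>i. i \<in> S \<Longrightarrow> \<alpha> i = \<alpha>' i" for \<alpha> \<alpha>'
      using that by (intro insert.prems(2)) (auto simp: K'_def)
    fix z :: "'i \<Rightarrow> complex"
    define P where "P = (\<Sum>\<alpha>\<in>K. monom (c \<alpha> * (\<Prod>i\<in>S. z i ^ \<alpha> i)) (\<alpha> j))"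
    have "poly P t = 0" for t
    proof -
      have "(\<Prod>i\<in>S. (z(j := t)) i ^ \<alpha> i) = (\<Prod>i\<in>S. z i ^ \<alpha> i)" for \<alpha>
        using insert.hyps(2) by (intro prod.cong) auto
      then have "poly P t = (\<Sum>\<alpha>\<in>K. c \<alpha> * (\<Prod>i\<in>insert j S. (z(j := t)) i ^ \<alpha> i))"
        unfolding P_def poly_sum using insert.hyps
        by (intro sum.cong) (simp_all add: poly_monom mult_ac)
      then show ?thesis using insert.prems(3) by simp
    qed
    then have "P = 0" by (metis poly_all_0_iff_0)
    then have "0 = coeff P (\<beta> j)" by simp
    also have "\<dots> = (\<Sum>\<alpha>\<in>K. if \<alpha> j = \<beta> j then c \<alpha> * (\<Prod>i\<in>S. z i ^ \<alpha> i) else 0)"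
      by (simp add: P_def coeff_sum)
    also have "\<dots> = (\<Sum>\<alpha>\<in>K'. c \<alpha> * (\<Prod>i\<in>S. z i ^ \<alpha> i))"
      unfolding K'_def using insert.prems(1) by (simp add: sum.inter_filter)
    finally show "(\<Sum>\<alpha>\<in>K'. c \<alpha> * (\<Prod>i\<in>S. z i ^ \<alpha> i)) = 0" by simp
  qed
qed

text \<open>
  The values of a homogeneous part and its coefficient vectors span the same subspace. Stated in
  dual form: a functional that kills all values kills all coefficients.
\<close>
lemma linear_functional_coeff_eq_0:
  fixes p :: "('n::finite, 'm::finite) vpoly" and l :: "complex ^ 'm \<Rightarrow> complex"
  assumes add: "\<And>x y. l (x + y) = l x + l y" and scale: "\<And>c x. l (c *s x) = c * l x"
    and zero: "\<And>z. l (homog_part p k z) = 0" and \<alpha>: "mi_degree \<alpha> = k"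
  shows "l (Poly_Mapping.lookup p \<alpha>) = 0"
proof (cases "\<alpha> \<in> Poly_Mapping.keys p")
  case False
  then show ?thesis using scale[of 0 0] by (simp add: in_keys_iff)
next
  case True
  have l_sum: "l (sum g S) = (\<Sum>i\<in>S. l (g i))" if "finite S" for g and S :: "('n \<Rightarrow> nat) set"
    using that scale[of 0 0] by (induction S rule: finite_induct) (simp_all add: add)
  define K where "K = {\<alpha> \<in> Poly_Mapping.keys p. mi_degree \<alpha> = k}"
  have "finite K" by (simp add: K_def)
  show ?thesis
  proof (rule monomials_independent[of UNIV K "\<lambda>\<alpha>. l (Poly_Mapping.lookup p \<alpha>)"])
    fix z :: "'n \<Rightarrow> complex"
    have "0 = l (homog_part p k (\<chi> i. z i))" by (simp add: zero)
    also have "\<dots> = (\<Sum>\<alpha>\<in>K. l (Poly_Mapping.lookup p \<alpha>) * (\<Prod>i\<in>UNIV. z i ^ \<alpha> i))"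
      unfolding homog_part_def K_def [symmetric] l_sum[OF \<open>finite K\<close>]
      by (simp add: scale mi_power_def mult.commute)
    finally show "(\<Sum>\<alpha>\<in>K. l (Poly_Mapping.lookup p \<alpha>) * (\<Prod>i\<in>UNIV. z i ^ \<alpha> i)) = 0" by simp
  qed (use True \<alpha> in \<open>auto simp: K_def\<close>)
qed

lemma homog_part_degree_nonzero:
  fixes p :: "('n::finite, 'm::finite) vpoly"
  assumes "p \<noteq> 0"
  obtains v where "homog_part p (vpoly_degree p) v \<noteq> 0"
proof -
  have "vpoly_degree p \<in> mi_degree ` Poly_Mapping.keys p"
    unfolding vpoly_degree_def by (rule Max_in) (use assms in auto)
  then obtain \<alpha> where \<alpha>: "\<alpha> \<in> Poly_Mapping.keys p" "mi_degree \<alpha> = vpoly_degree p" by auto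
  then obtain j where j: "Poly_Mapping.lookup p \<alpha> $ j \<noteq> 0"
    by (auto simp: in_keys_iff vec_eq_iff)
  show ?thesis
  proof (rule ccontr)
    assume "\<not> thesis"
    then have "homog_part p (vpoly_degree p) v = 0" for v using that by blast
    then have "Poly_Mapping.lookup p \<alpha> $ j = 0"
      by (intro linear_functional_coeff_eq_0[where l = "\<lambda>x. x $ j", OF _ _ _ \<alpha>(2)]) simp_all
    with j show False ..
  qed
qed

lemma holomorphic_map_on_poly_map: "holomorphic_map_on (poly_map p) S"
  unfolding holomorphic_map_on_def
proof
  fix z :: "complex ^ 'a"
  define g' where "g' \<alpha> h =
      (\<Sum>i\<in>UNIV. (of_nat (\<alpha> i) * h $ i * (z $ i) ^ (\<alpha> i - 1)) * (\<Prod>j\<in>UNIV - {i}. (z $ j) ^ \<alpha> j))"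
    for \<alpha> and h :: "complex ^ 'a"
  have "((\<lambda>z. mi_power z \<alpha>) has_derivative g' \<alpha>) (at z within S)" for \<alpha>
    unfolding mi_power_def g'_def
    by (intro has_derivative_prod has_derivative_power bounded_linear_imp_has_derivative
        bounded_linear_vec_nth)
  then have "(poly_map p has_derivative
      (\<lambda>h. \<Sum>\<alpha>\<in>Poly_Mapping.keys p. g' \<alpha> h *s Poly_Mapping.lookup p \<alpha>)) (at z within S)"
    unfolding poly_map_def [abs_def] mi_power_def [symmetric]
    by (intro has_derivative_sum bounded_linear.has_derivative[OF
        bounded_bilinear.bounded_linear_left[OF bounded_bilinear_scale_vec]])
  moreover have "complex_linear (\<lambda>h. \<Sum>\<alpha>\<in>Poly_Mapping.keys p. g' \<alpha> h *s Poly_Mapping.lookup p \<alpha>)"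
  proof (rule complex_linearI)
    have add: "g' \<alpha> (x + y) = g' \<alpha> x + g' \<alpha> y" and scale: "g' \<alpha> (c *s x) = c * g' \<alpha> x" for \<alpha> x y c
      by (simp_all add: g'_def algebra_simps sum.distrib sum_distrib_left)
    show "(\<Sum>\<alpha>\<in>Poly_Mapping.keys p. g' \<alpha> (x + y) *s Poly_Mapping.lookup p \<alpha>) =
      (\<Sum>\<alpha>\<in>Poly_Mapping.keys p. g' \<alpha> x *s Poly_Mapping.lookup p \<alpha>) +
      (\<Sum>\<alpha>\<in>Poly_Mapping.keys p. g' \<alpha> y *s Poly_Mapping.lookup p \<alpha>)" for x y
      by (simp add: add vec.scale_left_distrib sum.distrib)
    show "(\<Sum>\<alpha>\<in>Poly_Mapping.keys p. g' \<alpha> (c *s x) *s Poly_Mapping.lookup p \<alpha>) =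
      c *s (\<Sum>\<alpha>\<in>Poly_Mapping.keys p. g' \<alpha> x *s Poly_Mapping.lookup p \<alpha>)" for c x
      by (simp add: scale vec.scale_sum_right vec.scale_scale)
  qed
  ultimately show "\<exists>f'. complex_linear f' \<and> (poly_map p has_derivative f') (at z within S)"
    by blast
qed

lemma continuous_on_poly_map: "continuous_on S (poly_map p)"
  using holomorphic_map_on_poly_map[of p S]
  by (auto simp: holomorphic_map_on_def continuous_on_eq_continuous_within
      intro: has_derivative_continuous)

section \<open>Polynomial functions of one variable\<close>

definition poly_fun :: "(complex \<Rightarrow> complex) \<Rightarrow> bool" where
  "poly_fun g \<longleftrightarrow> (\<exists>P. \<forall>t. g t = poly P t)"

definition poly_curve :: "(complex \<Rightarrow> complex ^ 'm::finite) \<Rightarrow> bool" where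
  "poly_curve g \<longleftrightarrow> (\<forall>j. poly_fun (\<lambda>t. g t $ j))"

lemma poly_fun_const [intro]: "poly_fun (\<lambda>t. c)"
  unfolding poly_fun_def by (rule exI[of _ "[:c:]"]) simp

lemma poly_fun_id [intro]: "poly_fun (\<lambda>t. t)"
  unfolding poly_fun_def by (rule exI[of _ "[:0, 1:]"]) simp

lemma poly_fun_add [intro]: "poly_fun g \<Longrightarrow> poly_fun h \<Longrightarrow> poly_fun (\<lambda>t. g t + h t)"
  unfolding poly_fun_def by (metis poly_add)

lemma poly_fun_diff [intro]: "poly_fun g \<Longrightarrow> poly_fun h \<Longrightarrow> poly_fun (\<lambda>t. g t - h t)"
  unfolding poly_fun_def by (metis poly_diff)

lemma poly_fun_mult [intro]: "poly_fun g \<Longrightarrow> poly_fun h \<Longrightarrow> poly_fun (\<lambda>t. g t * h t)"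
  unfolding poly_fun_def by (metis poly_mult)

lemma poly_fun_power [intro]: "poly_fun g \<Longrightarrow> poly_fun (\<lambda>t. g t ^ n)"
  unfolding poly_fun_def by (metis poly_power)

lemma poly_fun_sum [intro]: "(\<And>i. i \<in> S \<Longrightarrow> poly_fun (g i)) \<Longrightarrow> poly_fun (\<lambda>t. \<Sum>i\<in>S. g i t)"
  by (induction S rule: infinite_finite_induct) auto

lemma poly_fun_prod [intro]: "(\<And>i. i \<in> S \<Longrightarrow> poly_fun (g i)) \<Longrightarrow> poly_fun (\<lambda>t. \<Prod>i\<in>S. g i t)"
  by (induction S rule: infinite_finite_induct) auto

lemma poly_curve_const [intro]: "poly_curve (\<lambda>t. v)"
  by (auto simp: poly_curve_def)

lemma poly_curve_add [intro]: "poly_curve g \<Longrightarrow> poly_curve h \<Longrightarrow> poly_curve (\<lambda>t. g t + h t)"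
  and poly_curve_diff [intro]: "poly_curve g \<Longrightarrow> poly_curve h \<Longrightarrow> poly_curve (\<lambda>t. g t - h t)"
  and poly_curve_scale [intro]: "poly_fun c \<Longrightarrow> poly_curve g \<Longrightarrow> poly_curve (\<lambda>t. c t *s g t)"
  by (auto simp: poly_curve_def)

lemma poly_curve_sum [intro]: "(\<And>i. i \<in> S \<Longrightarrow> poly_curve (g i)) \<Longrightarrow> poly_curve (\<lambda>t. \<Sum>i\<in>S. g i t)"
  by (auto simp: poly_curve_def)

lemma poly_fun_hinner [intro]: "poly_curve g \<Longrightarrow> poly_fun (\<lambda>t. hinner (g t) b)"
  unfolding poly_curve_def hinner_def by (intro poly_fun_sum poly_fun_mult poly_fun_const) simp

lemma poly_curve_linear [intro]:
  assumes U: "complex_linear U" and g: "poly_curve g"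
  shows "poly_curve (\<lambda>t. U (g t))"
proof -
  have eq: "U (g t) = matrix U *v g t" for t
    by (simp add: matrix_works[OF U])
  show ?thesis
    unfolding eq poly_curve_def matrix_vector_mult_def vec_lambda_beta
    by (intro allI poly_fun_sum poly_fun_mult poly_fun_const) (use g in \<open>simp add: poly_curve_def\<close>)
qed

lemma poly_curve_homog_part [intro]: "poly_curve g \<Longrightarrow> poly_curve (\<lambda>t. homog_part p k (g t))"
  unfolding homog_part_def mi_power_def
  by (intro poly_curve_sum poly_curve_scale poly_fun_prod poly_fun_power poly_curve_const)
    (simp add: poly_curve_def)

lemma poly_curve_poly_map [intro]: "poly_curve g \<Longrightarrow> poly_curve (\<lambda>t. poly_map p (g t))"
  unfolding poly_map_homog_parts by auto

lemma poly_curve_mobius_num [intro]: "poly_curve g \<Longrightarrow> poly_curve (\<lambda>t. mobius_num a (g t))"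
  unfolding mobius_num_def divide_inverse
  by (intro poly_curve_diff poly_curve_scale poly_curve_const poly_fun_mult poly_fun_const
      poly_fun_hinner)

lemma poly_fun_finite_zeros:
  assumes "poly_fun g" "g s \<noteq> 0"
  shows "finite {t. g t = 0}"
proof -
  obtain P where P: "\<And>t. g t = poly P t" using assms(1) by (auto simp: poly_fun_def)
  with assms(2) have "P \<noteq> 0" by auto
  then show ?thesis by (simp add: P poly_roots_finite)
qed

lemma poly_fun_eqI:
  assumes g: "poly_fun g" and h: "poly_fun h" and r: "r > 0"
    and eq: "\<And>t. cmod t < r \<Longrightarrow> g t = h t"
  shows "g t = h t"
proof (rule ccontr)
  assume "g t \<noteq> h t"
  then have "finite {t. g t - h t = 0}"
    by (intro poly_fun_finite_zeros[of _ t] poly_fun_diff g h) simp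
  moreover have "ball 0 r \<subseteq> {t. g t - h t = 0}" using eq by auto
  ultimately have "finite (ball (0::complex) r)" by (rule finite_subset[rotated])
  then show False using r uncountable_ball[of r "0::complex"] by (simp add: countable_finite)
qed

text \<open>
  All \<open>d\<close> zeros of \<open>(1 - t)\<^sup>d\<close> at \<open>1\<close> have to be zeros of \<open>R\<close>, because \<open>Q\<close> does not vanish there;
  the degree bound leaves room for nothing but a constant factor.
\<close>
lemma poly_eq_power_of_one_minus:
  fixes Q R L :: "complex poly"
  assumes eq: "\<And>t. poly R t * poly Q t = (1 - t) ^ d * poly L t"
    and Q: "poly Q 1 \<noteq> 0" and deg: "degree R \<le> d" and R0: "poly R 0 = 1"
  shows "poly R t = (1 - t) ^ d"
proof -
  have R: "R \<noteq> 0" using R0 by auto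
  have Q0: "Q \<noteq> 0" using Q by auto
  have "(1 - t) ^ d = (- 1) ^ d * (t - 1) ^ d" for t :: complex
    by (simp flip: power_mult_distrib)
  then have "poly (R * Q) = poly ([:-1, 1:] ^ d * smult ((-1) ^ d) L)"
    by (simp add: fun_eq_iff eq poly_power)
  then have "R * Q = [:-1, 1:] ^ d * smult ((-1) ^ d) L" by (simp only: poly_eq_poly_eq_iff)
  then have "[:-1, 1:] ^ d dvd R * Q" by (rule dvdI)
  then have "d \<le> order 1 (R * Q)" using R Q0 by (simp add: order_divides)
  also have "\<dots> = order 1 R" using R Q0 Q by (simp add: order_mult order_0I)
  finally have "[:-1, 1:] ^ d dvd R" using R by (simp add: order_divides)
  then obtain S where S: "R = [:-1, 1:] ^ d * S" by blast
  with R have "S \<noteq> 0" by auto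
  then have "degree R = d + degree S"
    unfolding S by (subst degree_mult_eq) (simp_all add: degree_power_eq)
  with deg have "degree S = 0" by simp
  then obtain s where s: "S = [:s:]" by (rule degree_eq_zeroE)
  have "(- 1) ^ d * s = 1" using R0 by (simp add: S s poly_power mult.commute)
  have "poly R t = (t - 1) ^ d * s" by (simp add: S s poly_power)
  also have "\<dots> = (1 - t) ^ d * ((- 1) ^ d * s)"
    by (simp flip: power_mult_distrib mult.assoc)
  finally show ?thesis using \<open>(- 1) ^ d * s = 1\<close> by simp
qed

section \<open>Symmetries of a nonlinear polynomial map fix the origin\<close>

text \<open>
  \<open>homogenization p\<close> is the homogeneous polynomial of degree \<open>d\<close> in \<open>(w, c)\<close> that restricts to
  \<open>poly_map p\<close> at \<open>c = 1\<close>. It clears the denominator of \<open>f \<circ> \<phi>\<^sub>a\<close>, and its value at \<open>c = 0\<close>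
  shows that no power of the denominator cancels.
\<close>
definition homogenization ::
    "('n::finite, 'm::finite) vpoly \<Rightarrow> complex ^ 'n \<Rightarrow> complex \<Rightarrow> complex ^ 'm" where
  "homogenization p w c = (\<Sum>k\<le>vpoly_degree p. c ^ (vpoly_degree p - k) *s homog_part p k w)"

lemma homogenization_at_infinity: "homogenization p w 0 = homog_part p (vpoly_degree p) w"
proof -
  have "homogenization p w 0
      = (\<Sum>k\<le>vpoly_degree p. if k = vpoly_degree p then homog_part p k w else 0)"
    unfolding homogenization_def by (intro sum.cong) (auto simp: zero_power)
  then show ?thesis by simp
qed

lemma homogenization_eq_poly_map:
  assumes "c \<noteq> 0"
  shows "homogenization p w c = c ^ vpoly_degree p *s poly_map p ((1 / c) *s w)"
  unfolding homogenization_def poly_map_scale vec.scale_sum_right vec.scale_scale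
  by (intro sum.cong refl) (simp add: assms power_diff power_one_over)

lemma poly_curve_homogenization:
  "poly_curve g \<Longrightarrow> poly_fun c \<Longrightarrow> poly_curve (\<lambda>t. homogenization p (g t) (c t))"
  unfolding homogenization_def
  by (intro poly_curve_sum poly_curve_scale poly_fun_power poly_curve_homog_part)

text \<open>
  On the line \<open>t \<mapsto> t *s z\<^sub>0\<close> the denominator \<open>1 - \<langle>z, a\<rangle>\<close> becomes \<open>1 - t\<close>, and the functional
  equation turns into \<open>den \<cdot> num = (1 - t)\<^sup>d \<cdot> num'\<close> between polynomials in \<open>t\<close>. The assumption on the
  top degree part says that \<open>num\<close> does not vanish at \<open>t = 1\<close>, that is, that \<open>f \<circ> \<gamma>\<close> has a pole
  of full order \<open>d\<close> at \<open>z\<^sub>0\<close>.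
\<close>
lemma denominator_along_line:
  fixes p :: "('n::finite, 'm::finite) vpoly"
  assumes a: "norm a < 1" and b: "norm b < 1"
    and U: "complex_linear U" and V: "complex_linear V"
    and eq: "\<And>z. norm z < 1 \<Longrightarrow> poly_map p (U (mobius a z)) = V (mobius b (poly_map p z))"
    and ball: "\<And>z. norm z < 1 \<Longrightarrow> norm (poly_map p z) < 1"
    and p0: "poly_map p 0 = 0"
    and z0: "hinner z\<^sub>0 a = 1"
    and top: "homog_part p (vpoly_degree p) (U (mobius_num a z\<^sub>0)) \<noteq> 0"
  shows "1 - hinner (poly_map p (t *s z\<^sub>0)) b = (1 - t) ^ vpoly_degree p"
proof -
  define d where "d = vpoly_degree p"
  obtain j where j: "homog_part p d (U (mobius_num a z\<^sub>0)) $ j \<noteq> 0"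
    using top by (auto simp: vec_eq_iff d_def)
  define num where "num t = homogenization p (U (mobius_num a (t *s z\<^sub>0))) (1 - t) $ j" for t
  define num' where "num' t = V (mobius_num b (poly_map p (t *s z\<^sub>0))) $ j" for t
  define den where "den t = 1 - hinner (poly_map p (t *s z\<^sub>0)) b" for t
  have line: "poly_curve (\<lambda>t. t *s z\<^sub>0)" by (intro poly_curve_scale poly_fun_id poly_curve_const)
  have "poly_curve (\<lambda>t. homogenization p (U (mobius_num a (t *s z\<^sub>0))) (1 - t))"
    by (intro poly_curve_homogenization poly_curve_linear[OF U] poly_curve_mobius_num line
        poly_fun_diff poly_fun_const poly_fun_id)
  then have num: "poly_fun num" by (simp add: poly_curve_def num_def [abs_def])
  have "poly_curve (\<lambda>t. V (mobius_num b (poly_map p (t *s z\<^sub>0))))"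
    by (intro poly_curve_linear[OF V] poly_curve_mobius_num poly_curve_poly_map line)
  then have num': "poly_fun num'" by (simp add: poly_curve_def num'_def [abs_def])
  have den: "poly_fun den"
    unfolding den_def
    by (intro poly_fun_diff poly_fun_const poly_fun_hinner poly_curve_poly_map line)
  \<comment> \<open>The functional equation holds only inside the ball, that is, for small \<open>t\<close>; polynomial
    identity extends it to all \<open>t\<close>, in particular to the pole at \<open>t = 1\<close>.\<close>
  have near: "den t * num t = (1 - t) ^ d * num' t" if t: "cmod t < 1 / (norm z\<^sub>0 + 1)" for t
  proof -
    define z y where "z = t *s z\<^sub>0" and "y = poly_map p z"
    have "norm z \<le> cmod t * (norm z\<^sub>0 + 1)" by (simp add: z_def norm_scale_vec mult_left_mono)
    also have "\<dots> < 1" using t by (simp add: pos_less_divide_eq add_nonneg_pos)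
    finally have z: "norm z < 1" .
    have za: "hinner z a = t" by (simp add: z_def hinner_scale_left z0)
    have t1: "1 - t \<noteq> 0" using mobius_denominator_nonzero[OF a z] by (simp add: za)
    have y1: "1 - hinner y b \<noteq> 0"
      using mobius_denominator_nonzero[OF b ball[OF z]] by (simp add: y_def)
    have "num t = (1 - t) ^ d * poly_map p (U (mobius a z)) $ j"
      unfolding num_def homogenization_eq_poly_map[OF t1] z_def[symmetric] d_def
      by (simp add: mobius_def za vec.linear_scale[OF U])
    also have "poly_map p (U (mobius a z)) = (1 / (1 - hinner y b)) *s V (mobius_num b y)"
      unfolding eq[OF z] y_def [symmetric] mobius_def[of b] vec.linear_scale[OF V] ..
    finally show ?thesis
      using y1 by (simp add: den_def num'_def z_def[symmetric] y_def[symmetric])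
  qed
  have lhs: "poly_fun (\<lambda>t. den t * num t)" by (intro poly_fun_mult num den)
  have rhs: "poly_fun (\<lambda>t. (1 - t) ^ d * num' t)"
    by (intro poly_fun_mult poly_fun_power poly_fun_diff poly_fun_const poly_fun_id num')
  have global: "den t * num t = (1 - t) ^ d * num' t" for t
    by (rule poly_fun_eqI[OF lhs rhs _ near]) (auto simp: add_nonneg_pos)
  obtain Q where Q: "\<And>t. num t = poly Q t" using num by (auto simp: poly_fun_def)
  obtain L where L: "\<And>t. num' t = poly L t" using num' by (auto simp: poly_fun_def)
  define R where "R = 1 - (\<Sum>k\<le>d. monom (hinner (homog_part p k z\<^sub>0) b) k)"
  have R: "den t = poly R t" for t
    by (simp add: den_def R_def poly_map_scale poly_sum poly_monom hinner_sum_left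
        hinner_scale_left mult.commute d_def)
  have "poly R t = (1 - t) ^ d"
  proof (rule poly_eq_power_of_one_minus)
    show "poly R t * poly Q t = (1 - t) ^ d * poly L t" for t
      using global[of t] by (simp add: R Q L)
    show "poly Q 1 \<noteq> 0"
      using j by (simp add: Q[symmetric] num_def homogenization_at_infinity d_def)
    show "degree R \<le> d"
      unfolding R_def
      by (intro degree_diff_le degree_sum_le) (auto intro: order.trans[OF degree_monom_le])
    show "poly R 0 = 1" by (simp add: R[symmetric] den_def p0)
  qed
  then show ?thesis by (simp add: R[symmetric] den_def d_def)
qed

text \<open>
  The top degree part may vanish at \<open>U a\<close>, but not on a whole neighbourhood. The witness \<open>v\<close> is
  taken where the top degree part of \<open>f \<circ> U\<close> is nonzero; on the line through \<open>a\<close> with direction \<open>v\<close>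
  it is then a nonzero polynomial, so its zeros are isolated.
\<close>
lemma homog_part_perturbation:
  fixes p :: "('n::finite, 'm::finite) vpoly"
  assumes "p \<noteq> 0" and U: "hermitian_isometry U"
  obtains v where
    "eventually (\<lambda>\<epsilon>. homog_part p (vpoly_degree p) (U (a + \<epsilon> *s v)) \<noteq> 0) (at 0)"
proof -
  define d where "d = vpoly_degree p"
  obtain v' where v': "homog_part p d v' \<noteq> 0"
    using homog_part_degree_nonzero[OF assms(1)] by (auto simp: d_def)
  obtain W where "\<And>x. U (W x) = x" using hermitian_isometry_inverse[OF U] by metis
  then have v: "homog_part p d (U (W v')) \<noteq> 0" using v' by simp
  define v where "v = W v'"
  obtain j where j: "homog_part p d (U v) $ j \<noteq> 0"
    using v by (auto simp: vec_eq_iff v_def)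
  have lin: "complex_linear U" using U by (rule hermitian_isometry_linear)
  have pf: "poly_fun (\<lambda>t. homog_part p d (U (x + t *s y)) $ j)" for x y
  proof -
    have "poly_curve (\<lambda>t. homog_part p d (U (x + t *s y)))"
      by (intro poly_curve_homog_part poly_curve_linear[OF lin] poly_curve_add poly_curve_const
          poly_curve_scale poly_fun_id)
    then show ?thesis by (simp add: poly_curve_def)
  qed
  \<comment> \<open>With \<open>\<tau> = 1 / \<epsilon>\<close> the direction \<open>v\<close> corresponds to \<open>\<tau> = 0\<close>, where the polynomial is nonzero.\<close>
  have "finite {\<tau>. homog_part p d (U (v + \<tau> *s a)) $ j = 0}"
    by (rule poly_fun_finite_zeros[OF pf, where s = 0]) (use j in simp)
  then have "finite (insert 0 {\<tau>. homog_part p d (U (v + \<tau> *s a)) $ j = 0})" by simp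
  then obtain \<tau> where \<tau>: "\<tau> \<noteq> 0" "homog_part p d (U (v + \<tau> *s a)) $ j \<noteq> 0"
    using ex_new_if_finite[OF infinite_UNIV_char_0] by blast
  have "U (a + (1 / \<tau>) *s v) = (1 / \<tau>) *s U (v + \<tau> *s a)"
    using \<tau>(1) by (simp add: vec.linear_add[OF lin] vec.linear_scale[OF lin] vec_eq_iff field_simps)
  then have "homog_part p d (U (a + (1 / \<tau>) *s v)) $ j \<noteq> 0"
    using \<tau> by (simp add: homog_part_scale)
  then have fin: "finite {\<epsilon>. homog_part p d (U (a + \<epsilon> *s v)) $ j = 0}"
    by (rule poly_fun_finite_zeros[OF pf])
  have "eventually (\<lambda>\<epsilon>. \<epsilon> \<in> - ({\<epsilon>. homog_part p d (U (a + \<epsilon> *s v)) $ j = 0} - {0})) (nhds 0)"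
    by (intro eventually_nhds_in_open open_Compl finite_imp_closed finite_Diff fin) simp
  then have "eventually (\<lambda>\<epsilon>. homog_part p d (U (a + \<epsilon> *s v)) \<noteq> 0) (at 0)"
    unfolding eventually_at_filter by eventually_elim auto
  then show ?thesis using that by (simp add: d_def)
qed

text \<open>
  The identity \<open>1 - \<langle>f(t z\<^sub>0), b\<rangle> = (1 - t)\<^sup>d\<close> is wanted at \<open>z\<^sub>0 = a / |a|\<^sup>2\<close> and \<open>t = |a|\<^sup>2\<close>, where
  \<open>t z\<^sub>0 = a\<close>. As the pole of \<open>f \<circ> \<gamma>\<close> can have smaller order at this particular point of the
  hyperplane \<open>\<langle>z, a\<rangle> = 1\<close>, it is approached by points \<open>zz \<epsilon>\<close> of the hyperplane at which the order
  is \<open>d\<close>, and the identity passes to the limit.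
\<close>
lemma symmetry_center_eq_0:
  fixes p :: "('n::finite, 'm::finite) vpoly"
  assumes a: "norm a < 1"
    and U: "hermitian_isometry U" and V: "hermitian_isometry V"
    and b: "b = poly_map p a"
    and eq: "\<And>z. norm z < 1 \<Longrightarrow> poly_map p (U (mobius a z)) = V (mobius b (poly_map p z))"
    and ball: "poly_map p ` ball 0 1 \<subseteq> ball 0 1"
    and p0: "poly_map p 0 = 0" and p: "p \<noteq> 0" and deg: "vpoly_degree p \<ge> 2"
  shows "a = 0"
proof (rule ccontr)
  assume "a \<noteq> 0"
  define d s A where "d = vpoly_degree p" and "s = mobius_scale a" and "A = hinner a a"
  have s: "s \<noteq> 0" "1 + s \<noteq> 0" "A = 1 - s\<^sup>2"
    using mobius_scale_nonzero[OF a] mobius_scale_square[OF a] by (simp_all add: s_def A_def)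
  have A: "A \<noteq> 0" using \<open>a \<noteq> 0\<close> by (simp add: A_def)
  have in_ball: "norm (poly_map p z) < 1" if "norm z < 1" for z
    using ball that by (auto simp: image_subset_iff)
  have b1: "norm b < 1" by (simp add: b in_ball a)
  obtain v where v: "eventually (\<lambda>\<epsilon>. homog_part p d (U (a + \<epsilon> *s v)) \<noteq> 0) (at 0)"
    using homog_part_perturbation[OF p U] unfolding d_def by metis
  define w where "w \<epsilon> = a + \<epsilon> *s v" for \<epsilon>
  \<comment> \<open>\<open>zz \<epsilon>\<close> is the point of the hyperplane \<open>\<langle>z, a\<rangle> = 1\<close> at which the Moebius numerator is a
    multiple of \<open>w \<epsilon>\<close>; so the numerator avoids the zeros of the top degree part.\<close>
  define zz where "zz \<epsilon> = (1 / (1 + s)) *s a + (s / hinner (w \<epsilon>) a) *s w \<epsilon>" for \<epsilon>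
  have w_lim: "(w \<longlongrightarrow> a) (at 0)"
  proof -
    have "((\<lambda>\<epsilon>. \<epsilon> *s v) \<longlongrightarrow> 0 *s v) (at 0)"
      by (rule bounded_linear.tendsto[OF bounded_bilinear.bounded_linear_left[OF
        bounded_bilinear_scale_vec] tendsto_ident_at])
    from tendsto_add[OF tendsto_const this, of a] show ?thesis by (simp add: w_def [abs_def])
  qed
  then have h_lim: "((\<lambda>\<epsilon>. hinner (w \<epsilon>) a) \<longlongrightarrow> A) (at 0)"
    unfolding A_def by (rule bounded_linear.tendsto[OF bounded_linear_hinner])
  have zz_lim: "((\<lambda>\<epsilon>. A *s zz \<epsilon>) \<longlongrightarrow> a) (at 0)"
  proof -
    have "((\<lambda>\<epsilon>. A *s zz \<epsilon>) \<longlongrightarrow> A *s ((1 / (1 + s)) *s a + (s / A) *s a)) (at 0)"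
      unfolding zz_def
      by (intro bounded_linear.tendsto[OF bounded_bilinear.bounded_linear_right[OF
            bounded_bilinear_scale_vec]] tendsto_add tendsto_const
          bounded_bilinear.tendsto[OF bounded_bilinear_scale_vec] tendsto_divide h_lim w_lim A)
    also have "A *s ((1 / (1 + s)) *s a + (s / A) *s a) = (A / (1 + s) + s) *s a"
      using A by (simp add: vec.scale_right_distrib vec.scale_scale vec.scale_left_distrib)
    also have "A / (1 + s) + s = 1"
      using s(2) by (simp add: s(3) field_simps power2_eq_square)
    finally show ?thesis by simp
  qed
  have "eventually (\<lambda>\<epsilon>. hinner (w \<epsilon>) a \<noteq> 0) (at 0)"
    by (rule tendsto_imp_eventually_ne[OF h_lim A])
  with v have "eventually (\<lambda>\<epsilon>. 1 - hinner (poly_map p (A *s zz \<epsilon>)) b = (1 - A) ^ d) (at 0)"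
  proof eventually_elim
    case (elim \<epsilon>)
    define c where "c = hinner (w \<epsilon>) a"
    have c: "c \<noteq> 0" using elim by (simp add: c_def)
    have "hinner (zz \<epsilon>) a = A / (1 + s) + s"
      using c by (simp add: zz_def hinner_simps flip: A_def c_def)
    also have "\<dots> = 1" using s(2) by (simp add: s(3) field_simps power2_eq_square)
    finally have zza: "hinner (zz \<epsilon>) a = 1" .
    have "mobius_num a (zz \<epsilon>) = a - (s / (1 + s)) *s a - (s\<^sup>2 / c) *s w \<epsilon> - (1 / (1 + s)) *s a"
      unfolding mobius_num_def zza s_def [symmetric]
      unfolding zz_def c_def [symmetric]
      by (simp add: vec_eq_iff algebra_simps power2_eq_square)
    also have "\<dots> = (1 - (s / (1 + s) + 1 / (1 + s))) *s a - (s\<^sup>2 / c) *s w \<epsilon>"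
      by (simp add: vec_eq_iff algebra_simps)
    also have "s / (1 + s) + 1 / (1 + s) = 1"
      using s(2) by (simp add: add.commute flip: add_divide_distrib)
    finally have num: "mobius_num a (zz \<epsilon>) = (- (s\<^sup>2 / c)) *s w \<epsilon>" by simp
    show ?case
      unfolding d_def
    proof (rule denominator_along_line[OF a b1 hermitian_isometry_linear[OF U]
          hermitian_isometry_linear[OF V] eq in_ball p0 zza])
      show "homog_part p (vpoly_degree p) (U (mobius_num a (zz \<epsilon>))) \<noteq> 0"
        unfolding num vec.linear_scale[OF hermitian_isometry_linear[OF U]] homog_part_scale
        using elim(1) s(1) c by (simp add: w_def d_def)
    qed auto
  qed
  moreover have "((\<lambda>\<epsilon>. 1 - hinner (poly_map p (A *s zz \<epsilon>)) b) \<longlongrightarrow> 1 - hinner b b) (at 0)"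
  proof -
    have "isCont (poly_map p) a"
      using continuous_on_poly_map[of UNIV p] by (simp add: continuous_on_eq_continuous_at)
    then have "((\<lambda>\<epsilon>. poly_map p (A *s zz \<epsilon>)) \<longlongrightarrow> b) (at 0)"
      unfolding b using zz_lim by (rule isCont_tendsto_compose)
    then show ?thesis
      by (intro tendsto_diff tendsto_const bounded_linear.tendsto[OF bounded_linear_hinner])
  qed
  ultimately have "((\<lambda>\<epsilon>::complex. (1 - A) ^ d) \<longlongrightarrow> 1 - hinner b b) (at 0)"
    by (rule Lim_transform_eventually[rotated])
  then have "1 - hinner b b = (1 - A) ^ d"
    by (simp add: tendsto_const_iff)
  then have "complex_of_real (1 - (norm b)\<^sup>2) = of_real ((1 - (norm a)\<^sup>2) ^ d)"
    by (simp add: A_def hinner_self)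
  then have key: "1 - (norm b)\<^sup>2 = (1 - (norm a)\<^sup>2) ^ d" by (simp only: of_real_eq_iff)
  have "norm b \<le> norm a"
    unfolding b by (rule schwarz_lemma_ball(1)[OF holomorphic_map_on_poly_map ball p0 a])
  then have "1 - (norm a)\<^sup>2 \<le> 1 - (norm b)\<^sup>2" by (simp add: power_mono)
  moreover have x: "0 < 1 - (norm a)\<^sup>2" "1 - (norm a)\<^sup>2 < 1"
    using a \<open>a \<noteq> 0\<close> by (simp_all add: abs_square_less_1)
  have "(1 - (norm a)\<^sup>2) ^ d < (1 - (norm a)\<^sup>2) ^ 1"
    using deg by (intro power_strict_decreasing x) (simp add: d_def)
  ultimately show False using key by simp
qed

section \<open>Orthogonal projections\<close>

lemma subspace_hcompl: "vec.subspace (hcompl A)"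
  by (auto simp: vec.subspace_def hcompl_def hinner_simps)

text \<open>
  The real orthogonal projection onto a complex subspace is also the Hermitian one, because being
  real-orthogonal to both \<open>w\<close> and \<open>\<i> *s w\<close> means being Hermitian-orthogonal to \<open>w\<close>.
\<close>
lemma hproj_exists:
  assumes A: "vec.subspace A"
  obtains y where "y \<in> A" "x - y \<in> hcompl A"
proof -
  have "subspace A"
    using A by (auto simp: vec.subspace_def subspace_def simp flip: of_real_scale_vec)
  then have span: "span A = A" by (simp add: span_eq_iff)
  obtain y z where yz: "y \<in> A" "\<And>w. w \<in> A \<Longrightarrow> orthogonal z w" "x = y + z"
    using orthogonal_subspace_decomp_exists[of A x] unfolding span by metis
  have "hinner z w = 0" if "w \<in> A" for w
  proof (rule complex_eqI)
    show "Re (hinner z w) = Re 0" using yz(2)[OF that] by (simp add: Re_hinner orthogonal_def)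
    have "\<i> *s w \<in> A" using A that by (rule vec.subspace_scale)
    then have "Re (hinner z (\<i> *s w)) = 0" using yz(2) by (simp add: Re_hinner orthogonal_def)
    then show "Im (hinner z w) = Im 0" by (simp add: hinner_scale_right)
  qed
  then have "x - y \<in> hcompl A" using yz(3) by (simp add: hcompl_def)
  with yz(1) show ?thesis using that by blast
qed

lemma hproj_eqI:
  assumes A: "vec.subspace A" and y: "y \<in> A" "x - y \<in> hcompl A"
  shows "hproj A x = y"
  unfolding hproj_def
proof (rule the_equality)
  fix y' assume y': "y' \<in> A \<and> x - y' \<in> hcompl A"
  have "y' - y \<in> A" using A y y' by (simp add: vec.subspace_diff)
  moreover have "(x - y) - (x - y') \<in> hcompl A"
    by (rule vec.subspace_diff[OF subspace_hcompl]) (use y y' in auto)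
  then have "y' - y \<in> hcompl A" by simp
  ultimately have "hinner (y' - y) (y' - y) = 0" unfolding hcompl_def by blast
  then show "y' = y" by simp
qed (use y in simp)

lemma
  assumes "vec.subspace A"
  shows hproj_mem: "hproj A x \<in> A"
    and hproj_compl: "x - hproj A x \<in> hcompl A"
  using hproj_exists[OF assms, of x] hproj_eqI[OF assms] by metis+

lemma norm_hproj_decomposition:
  assumes A: "vec.subspace A"
  shows "(norm (hproj A x))\<^sup>2 + (norm (x - hproj A x))\<^sup>2 = (norm x)\<^sup>2"
proof -
  have "hinner (x - hproj A x) (hproj A x) = 0"
    using hproj_mem[OF A] hproj_compl[OF A] by (auto simp: hcompl_def)
  then have "inner (x - hproj A x) (hproj A x) = 0" by (simp flip: Re_hinner)
  then show ?thesis by (simp add: power2_norm_eq_inner inner_diff inner_commute)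
qed

lemma orthogonal_to_hcompl_imp_mem:
  assumes A: "vec.subspace A" and x: "\<And>b. b \<in> hcompl A \<Longrightarrow> hinner x b = 0"
  shows "x \<in> A"
proof -
  define r where "r = x - hproj A x"
  have r: "r \<in> hcompl A" unfolding r_def by (rule hproj_compl[OF A])
  have "hinner r (hproj A x) = 0" using r hproj_mem[OF A] by (auto simp: hcompl_def)
  then have "hinner (hproj A x) r = 0" by (metis cnj_hinner complex_cnj_zero)
  then have "hinner r r = 0" using x[OF r] by (simp add: r_def hinner_diff_left)
  then have "x = hproj A x" by (simp add: r_def)
  then show ?thesis using hproj_mem[OF A] by metis
qed

section \<open>Isometries that intertwine the polynomial map\<close>

text \<open>
  Both sides of \<open>f (U (t *s z)) = V (f (t *s z))\<close> are polynomials in \<open>t\<close>, and the \<open>k\<close>-th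
  homogeneous parts are their coefficients.
\<close>
lemma homog_part_equivariant:
  fixes p :: "('n::finite, 'm::finite) vpoly"
  assumes U: "hermitian_isometry U" and V: "hermitian_isometry V"
    and eq: "\<And>z. norm z < 1 \<Longrightarrow> poly_map p (U z) = V (poly_map p z)"
    and k: "k \<le> vpoly_degree p"
  shows "homog_part p k (U z) = V (homog_part p k z)"
proof (unfold vec_eq_iff, rule allI)
  fix j
  define d where "d = vpoly_degree p"
  define P Q where "P = (\<Sum>k\<le>d. monom (homog_part p k (U z) $ j) k)"
    and "Q = (\<Sum>k\<le>d. monom (V (homog_part p k z) $ j) k)"
  have U_lin: "complex_linear U" and V_lin: "complex_linear V"
    using U V by (simp_all add: hermitian_isometry_linear)
  have near: "poly P t = poly Q t" if t: "cmod t < 1 / (norm z + 1)" for t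
  proof -
    have "norm (t *s z) \<le> cmod t * (norm z + 1)" by (simp add: norm_scale_vec mult_left_mono)
    also have "\<dots> < 1" using t by (simp add: pos_less_divide_eq add_nonneg_pos)
    finally have tz: "norm (t *s z) < 1" .
    have "poly P t = poly_map p (t *s U z) $ j"
      by (simp add: P_def poly_sum poly_monom poly_map_scale d_def mult.commute)
    also have "t *s U z = U (t *s z)" by (simp add: vec.linear_scale[OF U_lin])
    also have "poly_map p (U (t *s z)) = V (poly_map p (t *s z))" by (rule eq[OF tz])
    also have "V (poly_map p (t *s z)) $ j = poly Q t"
      by (simp add: Q_def poly_sum poly_monom poly_map_scale d_def mult.commute
          vec.linear_sum[OF V_lin] vec.linear_scale[OF V_lin])
    finally show ?thesis .
  qed
  have "poly P t = poly Q t" for t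
    by (rule poly_fun_eqI[OF _ _ _ near]) (auto simp: poly_fun_def add_nonneg_pos)
  then have "P = Q" by (simp add: poly_eq_poly_eq_iff[symmetric] fun_eq_iff)
  moreover have "coeff P k = homog_part p k (U z) $ j" "coeff Q k = V (homog_part p k z) $ j"
    using k by (simp_all add: P_def Q_def coeff_sum d_def)
  ultimately show "homog_part p k (U z) $ j = V (homog_part p k z) $ j" by simp
qed

lemma homog_part_lowest_mem: "homog_part p (lowest_order p) z \<in> lowest_coeff_span p"
  unfolding homog_part_def lowest_coeff_span_def
  by (intro vec.span_sum vec.span_scale vec.span_base) auto

lemma subspace_lowest_coeff_span: "vec.subspace (lowest_coeff_span p)"
  by (simp add: lowest_coeff_span_def)

text \<open>
  For \<open>b\<close> orthogonal to \<open>A\<close>, the functional \<open>x \<mapsto> hinner (V x) b\<close> kills the values of the lowest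
  order part \<open>f\<^sub>\<nu>\<close>, since \<open>V (f\<^sub>\<nu> z) = f\<^sub>\<nu> (U z)\<close> lies in \<open>A\<close>. Hence it kills the coefficients, so
  \<open>V\<close> maps them into \<open>A\<^sup>\<bottom>\<^sup>\<bottom> = A\<close>.
\<close>
lemma lowest_coeff_span_invariant:
  fixes p :: "('n::finite, 'm::finite) vpoly"
  assumes V: "hermitian_isometry V"
    and eq: "\<And>z. homog_part p (lowest_order p) (U z) = V (homog_part p (lowest_order p) z)"
  shows "V ` lowest_coeff_span p = lowest_coeff_span p"
proof (rule hermitian_isometry_image_subspace[OF V subspace_lowest_coeff_span])
  define C where "C = {Poly_Mapping.lookup p \<alpha> |\<alpha>. mi_degree \<alpha> = lowest_order p}"
  have lin: "complex_linear V" by (rule hermitian_isometry_linear[OF V])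
  have "V (Poly_Mapping.lookup p \<alpha>) \<in> lowest_coeff_span p" if "mi_degree \<alpha> = lowest_order p" for \<alpha>
  proof (rule orthogonal_to_hcompl_imp_mem[OF subspace_lowest_coeff_span])
    fix b assume b: "b \<in> hcompl (lowest_coeff_span p)"
    show "hinner (V (Poly_Mapping.lookup p \<alpha>)) b = 0"
    proof (rule linear_functional_coeff_eq_0[where l = "\<lambda>x. hinner (V x) b", OF _ _ _ that])
      fix z
      have "hinner b (homog_part p (lowest_order p) (U z)) = 0"
        using b homog_part_lowest_mem by (auto simp: hcompl_def)
      then show "hinner (V (homog_part p (lowest_order p) z)) b = 0"
        by (metis eq cnj_hinner complex_cnj_zero)
    qed (simp_all add: vec.linear_add[OF lin] vec.linear_scale[OF lin] hinner_simps)
  qed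
  then have "V ` C \<subseteq> lowest_coeff_span p" by (auto simp: C_def)
  then have "vec.span (V ` C) \<subseteq> lowest_coeff_span p"
    by (intro vec.span_minimal subspace_lowest_coeff_span)
  then show "V ` lowest_coeff_span p \<subseteq> lowest_coeff_span p"
    by (simp add: vec.linear_span_image[OF lin] lowest_coeff_span_def C_def)
qed

lemma hcompl_invariant:
  assumes V: "hermitian_isometry V" and A: "V ` A = A" and x: "x \<in> hcompl A"
  shows "V x \<in> hcompl A"
  unfolding hcompl_def
proof safe
  fix a assume "a \<in> A"
  then obtain a' where "a' \<in> A" "a = V a'" using A by blast
  then show "hinner (V x) a = 0"
    using x hermitian_isometry_hinner[OF V] by (simp add: hcompl_def)
qed

lemma hproj_isometry:
  assumes V: "hermitian_isometry V" and A: "V ` A = A" "vec.subspace A"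
  shows "hproj A (V x) = V (hproj A x)"
proof (rule hproj_eqI[OF A(2)])
  show "V (hproj A x) \<in> A" using A hproj_mem by blast
  have "V (x - hproj A x) \<in> hcompl A"
    by (rule hcompl_invariant[OF V A(1) hproj_compl[OF A(2)]])
  then show "V x - V (hproj A x) \<in> hcompl A"
    by (simp add: vec.linear_diff[OF hermitian_isometry_linear[OF V]])
qed

section \<open>Isometries of the tensor target\<close>

lemma norm_square_vec: "(norm x)\<^sup>2 = (\<Sum>i\<in>UNIV. (norm (x $ i))\<^sup>2)"
  by (simp add: norm_vec_def L2_set_def sum_nonneg)

lemma norm_square_vec_prod:
  "(norm x)\<^sup>2 = (\<Sum>i\<in>UNIV. \<Sum>j\<in>UNIV. (norm (x $ (i, j)))\<^sup>2)"
  unfolding norm_square_vec by (simp add: sum.cartesian_product flip: UNIV_Times_UNIV)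

lemma norm_dsum: "(norm (x \<oplus>\<^sub>v y))\<^sup>2 = (norm x)\<^sup>2 + (norm y)\<^sup>2"
  unfolding norm_square_vec
  by (subst UNIV_Plus_UNIV[symmetric], subst sum.Plus) (simp_all add: dsum_def)

lemma norm_tensor: "norm (x \<otimes>\<^sub>v y) = norm x * norm y"
proof -
  have "(norm (x \<otimes>\<^sub>v y))\<^sup>2 = (norm x * norm y)\<^sup>2"
    unfolding norm_square_vec_prod power_mult_distrib norm_square_vec[of x] norm_square_vec[of y]
    by (simp add: tensor_def norm_mult power_mult_distrib sum_product)
  then show ?thesis by (simp add: power2_eq_imp_eq)
qed

text \<open>
  \<open>V \<otimes> 1\<close> and \<open>1 \<otimes> U\<close>, given by letting \<open>V\<close> act on the columns and \<open>U\<close> on the rows of a tensor.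
  Their composition is \<open>V \<otimes> U\<close>, and in this form isometry is immediate column by column and row
  by row.
\<close>
definition left_factor_map ::
    "(complex ^ 'a::finite \<Rightarrow> complex ^ 'a) \<Rightarrow> complex ^ ('a \<times> 'b::finite) \<Rightarrow> complex ^ ('a \<times> 'b)" where
  "left_factor_map V x = (\<chi> k. V (\<chi> i. x $ (i, snd k)) $ fst k)"

definition right_factor_map ::
    "(complex ^ 'b::finite \<Rightarrow> complex ^ 'b) \<Rightarrow> complex ^ ('a::finite \<times> 'b) \<Rightarrow> complex ^ ('a \<times> 'b)" where
  "right_factor_map U x = (\<chi> k. U (\<chi> j. x $ (fst k, j)) $ snd k)"

lemma vec_lambda_add: "(\<chi> i. f i + g i) = (\<chi> i. f i) + (\<chi> i. g i)"
  and vec_lambda_scale: "(\<chi> i. c * f i) = c *s (\<chi> i. f i)"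
  by (simp_all add: vec_eq_iff)

lemma hermitian_isometry_left_factor:
  assumes V: "hermitian_isometry V"
  shows "hermitian_isometry (left_factor_map V :: complex ^ ('a::finite \<times> 'b::finite) \<Rightarrow> _)"
  unfolding hermitian_isometry_def
proof (intro conjI allI complex_linearI)
  note lin = hermitian_isometry_linear[OF V]
  fix x y :: "complex ^ ('a \<times> 'b)" and c
  show "left_factor_map V (x + y) = left_factor_map V x + left_factor_map V y"
    "left_factor_map V (c *s x) = c *s left_factor_map V x"
    by (simp_all add: left_factor_map_def vec_lambda_add vec_lambda_scale vec.linear_add[OF lin]
        vec.linear_scale[OF lin] vec_eq_iff)
  have "(norm (left_factor_map V x))\<^sup>2
      = (\<Sum>j\<in>UNIV. (norm (V (\<chi> i. x $ (i, j))))\<^sup>2)"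
    unfolding norm_square_vec_prod norm_square_vec[of "V _"] left_factor_map_def
    by (subst sum.swap) simp
  also have "\<dots> = (\<Sum>j\<in>UNIV. (norm (\<chi> i. x $ (i, j)))\<^sup>2)"
    by (simp add: hermitian_isometry_norm[OF V])
  also have "\<dots> = (norm x)\<^sup>2"
    unfolding norm_square_vec_prod[of x] norm_square_vec[of "vec_lambda _"]
    by (subst sum.swap) simp
  finally show "norm (left_factor_map V x) = norm x" by (simp add: power2_eq_imp_eq)
qed

lemma hermitian_isometry_right_factor:
  assumes U: "hermitian_isometry U"
  shows "hermitian_isometry (right_factor_map U :: complex ^ ('a::finite \<times> 'b::finite) \<Rightarrow> _)"
  unfolding hermitian_isometry_def
proof (intro conjI allI complex_linearI)
  note lin = hermitian_isometry_linear[OF U]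
  fix x y :: "complex ^ ('a \<times> 'b)" and c
  show "right_factor_map U (x + y) = right_factor_map U x + right_factor_map U y"
    "right_factor_map U (c *s x) = c *s right_factor_map U x"
    by (simp_all add: right_factor_map_def vec_lambda_add vec_lambda_scale vec.linear_add[OF lin]
        vec.linear_scale[OF lin] vec_eq_iff)
  have "(norm (right_factor_map U x))\<^sup>2
      = (\<Sum>i\<in>UNIV. (norm (U (\<chi> j. x $ (i, j))))\<^sup>2)"
    unfolding norm_square_vec_prod norm_square_vec[of "U _"] right_factor_map_def by simp
  also have "\<dots> = (\<Sum>i\<in>UNIV. (norm (\<chi> j. x $ (i, j)))\<^sup>2)"
    by (simp add: hermitian_isometry_norm[OF U])
  also have "\<dots> = (norm x)\<^sup>2"
    unfolding norm_square_vec_prod[of x] norm_square_vec[of "vec_lambda _"] by simp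
  finally show "norm (right_factor_map U x) = norm x" by (simp add: power2_eq_imp_eq)
qed

lemma left_factor_map_tensor:
  assumes "complex_linear V"
  shows "left_factor_map V (x \<otimes>\<^sub>v y) = V x \<otimes>\<^sub>v y"
proof -
  have eq: "(\<chi> i. (x \<otimes>\<^sub>v y) $ (i, j)) = y $ j *s x" for j
    by (simp add: tensor_def vec_eq_iff mult.commute)
  show ?thesis
    unfolding left_factor_map_def eq vec.linear_scale[OF assms]
    by (simp add: vec_eq_iff tensor_def mult.commute)
qed

lemma right_factor_map_tensor:
  assumes "complex_linear U"
  shows "right_factor_map U (x \<otimes>\<^sub>v y) = x \<otimes>\<^sub>v U y"
proof -
  have eq: "(\<chi> j. (x \<otimes>\<^sub>v y) $ (i, j)) = x $ i *s y" for i
    by (simp add: tensor_def vec_eq_iff)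
  show ?thesis
    unfolding right_factor_map_def eq vec.linear_scale[OF assms]
    by (simp add: vec_eq_iff tensor_def)
qed

definition dsum_map ::
    "(complex ^ 'a::finite \<Rightarrow> complex ^ 'a) \<Rightarrow> (complex ^ 'b::finite \<Rightarrow> complex ^ 'b)
      \<Rightarrow> complex ^ ('a + 'b) \<Rightarrow> complex ^ ('a + 'b)" where
  "dsum_map S T x = S (\<chi> i. x $ Inl i) \<oplus>\<^sub>v T (\<chi> j. x $ Inr j)"

lemma dsum_map_dsum: "dsum_map S T (x \<oplus>\<^sub>v y) = S x \<oplus>\<^sub>v T y"
  by (simp add: dsum_map_def dsum_def)

lemma dsum_add: "(x \<oplus>\<^sub>v y) + (x' \<oplus>\<^sub>v y') = (x + x') \<oplus>\<^sub>v (y + y')"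
  and dsum_scale: "c *s (x \<oplus>\<^sub>v y) = (c *s x) \<oplus>\<^sub>v (c *s y)"
  and dsum_0: "0 \<oplus>\<^sub>v 0 = 0"
  by (simp_all add: dsum_def vec_eq_iff split: sum.split)

lemma hermitian_isometry_dsum_map:
  assumes S: "hermitian_isometry S" and T: "hermitian_isometry T"
  shows "hermitian_isometry (dsum_map S T)"
  unfolding hermitian_isometry_def
proof (intro conjI allI complex_linearI)
  note lin = hermitian_isometry_linear[OF S] hermitian_isometry_linear[OF T]
  fix x y and c
  show "dsum_map S T (x + y) = dsum_map S T x + dsum_map S T y"
    "dsum_map S T (c *s x) = c *s dsum_map S T x"
    by (simp_all add: dsum_map_def vec_lambda_add vec_lambda_scale vec.linear_add[OF lin(1)]
        vec.linear_add[OF lin(2)] vec.linear_scale[OF lin(1)] vec.linear_scale[OF lin(2)]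
        dsum_add dsum_scale)
  have "x = (\<chi> i. x $ Inl i) \<oplus>\<^sub>v (\<chi> j. x $ Inr j)"
    by (simp add: dsum_def vec_eq_iff split: sum.split)
  then have "(norm x)\<^sup>2 = (norm (\<chi> i. x $ Inl i))\<^sup>2 + (norm (\<chi> j. x $ Inr j))\<^sup>2"
    by (metis norm_dsum)
  then have "(norm (dsum_map S T x))\<^sup>2 = (norm x)\<^sup>2"
    by (simp add: dsum_map_def norm_dsum hermitian_isometry_norm[OF S] hermitian_isometry_norm[OF T])
  then show "norm (dsum_map S T x) = norm x" by (simp add: power2_eq_imp_eq)
qed

lemma hermitian_isometry_compose:
  assumes S: "hermitian_isometry S" and T: "hermitian_isometry T"
  shows "hermitian_isometry (\<lambda>x. S (T x))"
  unfolding hermitian_isometry_def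
proof (intro conjI allI complex_linearI)
  note lin = hermitian_isometry_linear[OF S] hermitian_isometry_linear[OF T]
  show "S (T (x + y)) = S (T x) + S (T y)" for x y
    by (simp add: vec.linear_add[OF lin(1)] vec.linear_add[OF lin(2)])
  show "S (T (c *s x)) = c *s S (T x)" for c x
    by (simp add: vec.linear_scale[OF lin(1)] vec.linear_scale[OF lin(2)])
qed (simp add: hermitian_isometry_norm[OF S] hermitian_isometry_norm[OF T])

lemma subspace_tensor_target:
  "vec.subspace (tensor_target A :: (complex ^ ('m::finite \<times> 'n::finite + 'm)) set)"
proof -
  define S where "S = vec.span {a \<otimes>\<^sub>v z |a (z :: complex ^ 'n). a \<in> A}"
  have target: "x \<in> tensor_target A \<longleftrightarrow> (\<exists>u\<in>S. \<exists>v\<in>hcompl A. x = u \<oplus>\<^sub>v v)"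
    for x :: "complex ^ ('m \<times> 'n + 'm)"
    unfolding tensor_target_def S_def by blast
  have S: "vec.subspace S" by (simp add: S_def)
  note sub = S subspace_hcompl[of A]
  show ?thesis
    unfolding vec.subspace_def
  proof (intro conjI ballI allI)
    show "(0 :: complex ^ ('m \<times> 'n + 'm)) \<in> tensor_target A"
      unfolding target using sub[THEN vec.subspace_0] dsum_0 by metis
  next
    fix x y :: "complex ^ ('m \<times> 'n + 'm)"
    assume "x \<in> tensor_target A" "y \<in> tensor_target A"
    then obtain u v u' v' where "u \<in> S" "v \<in> hcompl A" "u' \<in> S" "v' \<in> hcompl A"
      "x = u \<oplus>\<^sub>v v" "y = u' \<oplus>\<^sub>v v'"
      unfolding target by blast
    then show "x + y \<in> tensor_target A"
      unfolding target using sub[THEN vec.subspace_add] dsum_add by blast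
  next
    fix c and x :: "complex ^ ('m \<times> 'n + 'm)"
    assume "x \<in> tensor_target A"
    then show "c *s x \<in> tensor_target A"
      unfolding target using sub[THEN vec.subspace_scale] dsum_scale by blast
  qed
qed

text \<open>
  \<open>T = (V \<otimes> U) \<oplus> V\<close>. It maps the generators \<open>a \<otimes> z\<close> of \<open>A \<otimes> \<complex>\<^sup>n\<close> to generators and, as \<open>V\<close> is
  unitary, preserves \<open>A\<^sup>\<bottom>\<close>; injectivity and dimension upgrade the inclusion of the image to
  equality.
\<close>
lemma tensor_target_isometry:
  fixes U :: "complex ^ 'n::finite \<Rightarrow> complex ^ 'n" and V :: "complex ^ 'm::finite \<Rightarrow> complex ^ 'm"
  assumes U: "hermitian_isometry U" and V: "hermitian_isometry V" and A: "V ` A = A"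
  obtains T where "hermitian_isometry T" "T ` tensor_target A = tensor_target A"
    "\<And>x z v. T ((x \<otimes>\<^sub>v z) \<oplus>\<^sub>v v) = (V x \<otimes>\<^sub>v U z) \<oplus>\<^sub>v V v"
proof -
  define S :: "complex ^ ('m \<times> 'n) \<Rightarrow> complex ^ ('m \<times> 'n)"
    where "S x = right_factor_map U (left_factor_map V x)" for x
  define T where "T = dsum_map S V"
  have S: "hermitian_isometry S"
    unfolding S_def [abs_def]
    by (rule hermitian_isometry_compose[OF hermitian_isometry_right_factor[OF U]
          hermitian_isometry_left_factor[OF V]])
  have T: "hermitian_isometry T"
    unfolding T_def by (rule hermitian_isometry_dsum_map[OF S V])
  have S_tensor: "S (x \<otimes>\<^sub>v z) = V x \<otimes>\<^sub>v U z" for x z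
    by (simp add: S_def left_factor_map_tensor right_factor_map_tensor U V hermitian_isometry_linear)
  have S_span: "S u \<in> vec.span {a \<otimes>\<^sub>v z |a z. a \<in> A}" if "u \<in> vec.span {a \<otimes>\<^sub>v z |a z. a \<in> A}" for u
  proof -
    have "V a \<in> A" if "a \<in> A" for a using A that by blast
    then have gen: "S ` {a \<otimes>\<^sub>v z |a z. a \<in> A} \<subseteq> {a \<otimes>\<^sub>v z |a z. a \<in> A}"
      by (auto simp: S_tensor) blast
    have "S u \<in> vec.span (S ` {a \<otimes>\<^sub>v z |a z. a \<in> A})"
      unfolding vec.linear_span_image[OF hermitian_isometry_linear[OF S]] using that by (rule imageI)
    then show ?thesis using vec.span_mono[OF gen] by (rule subsetD[rotated])
  qed
  have "T ` tensor_target A \<subseteq> tensor_target A"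
  proof
    fix y assume "y \<in> T ` tensor_target A"
    then obtain u v where uv: "u \<in> vec.span {a \<otimes>\<^sub>v z |a z. a \<in> A}" "v \<in> hcompl A"
      and "y = T (u \<oplus>\<^sub>v v)"
      unfolding tensor_target_def by blast
    then have "y = S u \<oplus>\<^sub>v V v" by (simp add: T_def dsum_map_dsum)
    then show "y \<in> tensor_target A"
      unfolding tensor_target_def using S_span[OF uv(1)] hcompl_invariant[OF V A uv(2)] by blast
  qed
  then have "T ` tensor_target A = tensor_target A"
    by (rule hermitian_isometry_image_subspace[OF T subspace_tensor_target])
  then show ?thesis using T that by (simp add: T_def dsum_map_dsum S_tensor)
qed

section \<open>Symmetries as unitary maps\<close>

lemma holomorphic_map_on_isometry:
  assumes T: "hermitian_isometry T" and eq: "\<And>z. z \<in> S \<Longrightarrow> \<phi> z = T z"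
  shows "holomorphic_map_on \<phi> S"
  unfolding holomorphic_map_on_def
proof
  fix z assume z: "z \<in> S"
  have "bounded_linear T"
    using complex_linear_imp_linear[OF hermitian_isometry_linear[OF T]]
    by (simp add: linear_conv_bounded_linear)
  then have T': "(T has_derivative T) (at z within S)" by (rule bounded_linear_imp_has_derivative)
  have "(\<phi> has_derivative T) (at z within S)"
    by (rule has_derivative_transform[OF z _ T']) (rule eq)
  then show "\<exists>f'. complex_linear f' \<and> (\<phi> has_derivative f') (at z within S)"
    using hermitian_isometry_linear[OF T] by blast
qed

lemma isometry_restrict_in_Aut_ball:
  assumes T: "hermitian_isometry T" and V: "T ` V = V"
  shows "restrict T (unit_ball V) \<in> Aut_ball V"
proof -
  obtain W where W: "hermitian_isometry W" "\<And>x. W (T x) = x" "\<And>x. T (W x) = x"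
    using hermitian_isometry_inverse[OF T] by metis
  have "W ` (T ` V) = V" by (simp add: image_image W(2))
  then have WV: "W ` V = V" by (simp add: V)
  have TB: "T z \<in> unit_ball V" and WB: "W z \<in> unit_ball V" if "z \<in> unit_ball V" for z
    using that V WV by (auto simp: unit_ball_def hermitian_isometry_norm T W(1))
  have bij: "bij_betw (restrict T (unit_ball V)) (unit_ball V) (unit_ball V)"
    by (rule bij_betw_byWitness[where f' = W]) (auto simp: W TB WB)
  have "inv_into (unit_ball V) (restrict T (unit_ball V)) z = W z" if "z \<in> unit_ball V" for z
    by (rule inv_into_f_eq) (use bij that WB W in \<open>auto simp: bij_betw_def\<close>)
  then have "holomorphic_map_on (inv_into (unit_ball V) (restrict T (unit_ball V))) (unit_ball V)"
    by (rule holomorphic_map_on_isometry[OF W(1)])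
  moreover have "holomorphic_map_on (restrict T (unit_ball V)) (unit_ball V)"
    by (rule holomorphic_map_on_isometry[OF T]) simp
  ultimately show ?thesis using bij by (simp add: Aut_ball_def)
qed

text \<open>
  Injectivity of \<open>\<psi>\<close> identifies the zero \<open>b\<close> of \<open>\<psi>\<close> with \<open>f a\<close>, where \<open>a\<close> is the zero of \<open>\<gamma>\<close>.
  Once \<open>a = 0\<close>, both Moebius factors are \<open>z \<mapsto> -z\<close> and are absorbed into the unitary factors.
\<close>
lemma symmetry_is_unitary:
  fixes p :: "('n::finite, 'm::finite) vpoly"
  assumes ball: "poly_map p ` ball 0 1 \<subseteq> ball 0 1" and p0: "poly_map p 0 = 0"
    and p: "p \<noteq> 0" and deg: "vpoly_degree p \<ge> 2"
    and \<gamma>: "\<gamma> \<in> Aut_ball UNIV" and \<psi>: "\<psi> \<in> Aut_ball UNIV"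
    and eq: "\<And>z. norm z < 1 \<Longrightarrow> poly_map p (\<gamma> z) = \<psi> (poly_map p z)"
  obtains U V where "hermitian_isometry U" "hermitian_isometry V"
    "\<And>z. norm z < 1 \<Longrightarrow> \<gamma> z = U z" "\<And>y. norm y < 1 \<Longrightarrow> \<psi> y = V y"
proof -
  obtain U a where U: "hermitian_isometry U" and a: "norm a < 1" "\<gamma> a = 0"
    and \<gamma>_eq: "\<And>z. norm z < 1 \<Longrightarrow> \<gamma> z = U (mobius a z)"
    using ball_automorphism_structure[OF \<gamma>] by blast
  obtain V b where V: "hermitian_isometry V" and b: "norm b < 1" "\<psi> b = 0"
    and \<psi>_eq: "\<And>y. norm y < 1 \<Longrightarrow> \<psi> y = V (mobius b y)"
    using ball_automorphism_structure[OF \<psi>] by blast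
  have in_ball: "norm (poly_map p z) < 1" if "norm z < 1" for z
    using ball that by (auto simp: image_subset_iff)
  have "\<psi> (poly_map p a) = \<psi> b" using eq[OF a(1)] a(2) b(2) p0 by simp
  moreover have "inj_on \<psi> (ball 0 1)"
    using \<psi> by (simp add: Aut_ball_def bij_betw_def unit_ball_UNIV)
  ultimately have b_eq: "b = poly_map p a"
    using a(1) b(1) in_ball by (auto dest: inj_onD)
  have "a = 0"
    by (rule symmetry_center_eq_0[OF a(1) U V b_eq _ ball p0 p deg])
      (simp add: eq in_ball flip: \<gamma>_eq \<psi>_eq)
  then have "b = 0" using b_eq p0 by simp
  have mobius_zero: "mobius 0 z = - z" for z :: "complex ^ 'k::finite"
    by (simp add: mobius_def mobius_num_def mobius_scale_def)
  have neg: "hermitian_isometry (\<lambda>x. W (- x))" if "hermitian_isometry W"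
    for W :: "complex ^ 'k::finite \<Rightarrow> complex ^ 'k"
  proof -
    have "hermitian_isometry (uminus :: complex ^ 'k \<Rightarrow> complex ^ 'k)"
      by (auto simp: hermitian_isometry_def intro!: complex_linearI)
    then show ?thesis by (rule hermitian_isometry_compose[OF that])
  qed
  show ?thesis
    by (rule that[OF neg[OF U] neg[OF V]])
      (simp_all add: \<gamma>_eq \<psi>_eq \<open>a = 0\<close> \<open>b = 0\<close> mobius_zero)
qed

lemma tensor_op_mem_unit_ball:
  assumes A: "vec.subspace A" and z: "norm z < 1" and f: "norm (f z) < 1"
  shows "tensor_op A f z \<in> unit_ball (tensor_target A)"
proof -
  have "tensor_op A f z \<in> tensor_target A"
    unfolding tensor_op_def tensor_target_def
    using hproj_mem[OF A] hproj_compl[OF A] by (blast intro: vec.span_base)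
  moreover have "(norm (tensor_op A f z))\<^sup>2 \<le> (norm (f z))\<^sup>2"
    unfolding tensor_op_def norm_dsum norm_tensor norm_hproj_decomposition[OF A, of "f z", symmetric]
    using z by (intro add_right_mono power_mono mult_left_le) auto
  then have "norm (tensor_op A f z) \<le> norm (f z)" by (rule power2_le_imp_le) simp
  ultimately show ?thesis using f by (simp add: unit_ball_def)
qed

theorem corollary4p1:
  fixes p :: "('n::finite, 'm::finite) vpoly"
    and f :: "complex ^ 'n \<Rightarrow> complex ^ 'm"
    and A :: "(complex ^ 'm) set"
  assumes "f = poly_map p"
    and "f ` ball 0 1 \<subseteq> ball 0 1"
    and "proper_map (top_of_set (ball 0 1)) (top_of_set (ball 0 1)) f"
    and "f 0 = 0"
    and "vpoly_degree p \<ge> 2"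
    and "A = lowest_coeff_span p"
  shows "hermitian_invariant_group UNIV f
           \<subseteq> hermitian_invariant_group (tensor_target A) (tensor_op A f)"
proof
  fix \<gamma> assume "\<gamma> \<in> hermitian_invariant_group UNIV f"
  then obtain \<psi> where \<gamma>: "\<gamma> \<in> Aut_ball UNIV" and \<psi>: "\<psi> \<in> Aut_ball UNIV"
    and eq: "\<And>z. norm z < 1 \<Longrightarrow> f (\<gamma> z) = \<psi> (f z)"
    by (auto simp: hermitian_invariant_group_def unit_ball_UNIV)
  \<comment> \<open>The zero map is not proper: its fibre over \<open>0\<close> is the whole open ball, which is not compact.\<close>
  have p: "p \<noteq> 0"
  proof
    assume "p = 0"
    then have "f x = 0" for x by (simp add: assms(1) poly_map_def)
    then have "{x \<in> ball 0 1. f x = 0} = ball 0 1" by blast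
    moreover have "compactin (top_of_set (ball 0 1)) {x \<in> topspace (top_of_set (ball 0 1)). f x = 0}"
      using assms(3) unfolding proper_map_def by auto
    ultimately have "compactin (top_of_set (ball 0 1)) (ball (0 :: complex ^ 'n) 1)"
      by (simp only: topspace_euclidean_subtopology)
    then have "compact (ball (0 :: complex ^ 'n) 1)"
      by (simp only: compactin_subtopology compactin_euclidean_iff)
    then have "ball (0 :: complex ^ 'n) 1 = UNIV"
      using clopen[of "ball (0 :: complex ^ 'n) 1"] compact_imp_closed by fastforce
    then have "axis undefined 1 \<in> ball (0 :: complex ^ 'n) 1" by simp
    then show False by simp
  qed
  obtain U V where U: "hermitian_isometry U" and V: "hermitian_isometry V"
    and \<gamma>U: "\<And>z. norm z < 1 \<Longrightarrow> \<gamma> z = U z" and \<psi>V: "\<And>y. norm y < 1 \<Longrightarrow> \<psi> y = V y"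
    using symmetry_is_unitary[of p \<gamma> \<psi>] assms(1,2,4,5) p \<gamma> \<psi> eq by metis
  have in_ball: "norm (f z) < 1" if "norm z < 1" for z
    using assms(2) that by (auto simp: image_subset_iff)
  have fUV: "f (U z) = V (f z)" if "norm z < 1" for z
    using eq[OF that] that by (simp add: \<gamma>U \<psi>V in_ball)
  have order: "lowest_order p \<le> vpoly_degree p"
  proof -
    obtain \<alpha> where "\<alpha> \<in> Poly_Mapping.keys p" using p by fastforce
    then have "lowest_order p \<le> mi_degree \<alpha>" "mi_degree \<alpha> \<le> vpoly_degree p"
      by (simp_all add: lowest_order_def vpoly_degree_ge)
    then show ?thesis by (rule order_trans)
  qed
  have sub: "vec.subspace A" by (simp add: assms(6) subspace_lowest_coeff_span)
  have A: "V ` A = A"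
    unfolding assms(6)
    by (rule lowest_coeff_span_invariant[OF V homog_part_equivariant[OF U V _ order]])
      (use fUV assms(1) in auto)
  obtain T where T: "hermitian_isometry T" "T ` tensor_target A = tensor_target A"
    and T_eq: "\<And>x z v. T ((x \<otimes>\<^sub>v z) \<oplus>\<^sub>v v) = (V x \<otimes>\<^sub>v U z) \<oplus>\<^sub>v V v"
    using tensor_target_isometry[OF U V A] by blast
  have "tensor_op A f (\<gamma> z) = restrict T (unit_ball (tensor_target A)) (tensor_op A f z)"
    if z: "z \<in> unit_ball UNIV" for z
  proof -
    have z: "norm z < 1" using that by (simp add: unit_ball_UNIV)
    have "tensor_op A f (\<gamma> z) = T (tensor_op A f z)"
      unfolding tensor_op_def T_eq
      by (simp add: \<gamma>U z fUV hproj_isometry[OF V A sub]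
          vec.linear_diff[OF hermitian_isometry_linear[OF V]])
    then show ?thesis
      using tensor_op_mem_unit_ball[OF sub z, of f] in_ball[OF z] by simp
  qed
  then show "\<gamma> \<in> hermitian_invariant_group (tensor_target A) (tensor_op A f)"
    unfolding hermitian_invariant_group_def
    using \<gamma> isometry_restrict_in_Aut_ball[OF T] by blast
qed

end
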